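(* Consider an interconnection of $n\ge 2$ hybrid subsystems with data $(f_i,g_i,C_i,D_i,\chi_i,U)$, $i=1,\dots,n$, with $D_i=D$ for all $i$, and the resulting overall hybrid system with data $(f,g,C,D,\chi,U)$. Assume that each subsystem has the asymptotic gain (AG) property with gains $\tilde\gamma_{ij},\tilde\gamma_i\in\mathcal{K}_\infty\cup\{0\}$, and that solutions of the overall system exist, are bounded, and some of them are complete. Put $\gamma_{ij}=\tilde\gamma_{ij}$ for $i\ne j$ and $\gamma_{ii}\equiv 0$, and let $\Gamma_{\max}:\mathbb{R}^n_+\to\mathbb{R}^n_+$, $(\Gamma_{\max}(s))_i=\max_{j\neq i}\gamma_{ij}(s_j)$. If $$\Gamma_{\max}(s)\not\ge s\qquad\text{for all } s\in\mathbb{R}^n_+,\ s\ne 0,$$ then the overall system satisfies the AG property. In particular, there is $\tilde\gamma\in\mathcal{K}_\infty\cup\{0\}$ such that any complete solution pair $(x,u)$ of the overall system satisfies $$\limsup_{(t,k)\in\mathrm{dom}\,x,\ t+k\to\infty}|x(t,k)|\le\tilde\gamma(\|u\|_\infty).$$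
   Context: Notation. $\mathbb{R}_+=[0,\infty)$, $\mathbb{N}_+=\{0,1,2,\dots\}$, $\mathbb{R}^n_+=\{s\in\mathbb{R}^n: s_i\ge 0\ \forall i\}$. For $x,y\in\mathbb{R}^n$: $x\ge y$ means $x_i\ge y_i$ for all $i$; $x\not\ge y$ means there is $i$ with $x_i<y_i$. A function $\gamma:\mathbb{R}_+\to\mathbb{R}_+$ is of class $\mathcal{K}$ if it is continuous, strictly increasing and $\gamma(0)=0$; of class $\mathcal{K}_\infty$ if moreover unbounded. $0$ in $\mathcal{K}_\infty\cup\{0\}$ is the zero function. Interconnected hybrid systems. Subsystem $i$ has state $x_i\in\chi_i\subset\mathbb{R}^{N_i}$, and there is an external input $u\in U\subset\mathbb{R}^M$. Let $\chi=\chi_1\times\dots\times\chi_n$, $x=(x_1^T,\dots,x_n^T)^T\in\chi\subset\mathbb{R}^N$, $N=\sum N_i$. Subsystem $i$ is $$\dot x_i=f_i(x_1,\dots,x_n,u),\ (x,u)\in C_i;\qquad x_i^+=g_i(x_1,\dots,x_n,u),\ (x,u)\in D_i,$$ with $C_i,D_i\subset\chi\times U$, $f_i:C_i\to\mathbb{R}^{N_i}$, $g_i:D_i\to\chi_i$. Standing regularity assumptions: $\chi_i$ is open, $U$ is closed, $C_i,D_i$ are relatively closed in $\chi\times U$, and $f_i,g_i$ are continuous. Overall system: $\dot x=f(x,u)$ for $(x,u)\in C$, $x^+=g(x,u)$ for $(x,u)\in D$, where $C=\bigcap_i C_i$, $D=\bigcup_i D_i$, $f=(f_1^T,\dots,f_n^T)^T$,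 $g=(\tilde g_1^T,\dots,\tilde g_n^T)^T$ with $\tilde g_i(x,u)=g_i(x,u)$ if $(x,u)\in D_i$ and $\tilde g_i(x,u)=x_i$ otherwise. Hybrid time domains and signals. A hybrid time domain is a subset of $\mathbb{R}_+\times\mathbb{N}_+$ that is a union of finitely or infinitely many intervals $[t_k,t_{k+1}]\times\{k\}$, where $0=t_0\le t_1\le\dots$ is a finite or infinite nondecreasing sequence of reals; the last interval, if it exists, may be of the form $[t_K,T)\times\{K\}$ with $T$ finite or $T=+\infty$. For elements of a hybrid time domain, $(s,l)\le(t,k)$ means $s+l\le t+k$. A hybrid signal is a function on a hybrid time domain. A hybrid input is a hybrid signal $u$ with $u(\cdot,k)$ Lebesgue measurable and locally essentially bounded for each $k$. A hybrid arc is a hybrid signal $x$ with $x(\cdot,k)$ locally absolutely continuous for each $k$. For a hybrid signal $u$ put $\Phi(u)=\{(s,l)\in\mathrm{dom}\,u:(s,l+1)\in\mathrm{dom}\,u\}$ and $$\|u\|_{(t,k)}=\max\Big\{\operatorname*{ess\,sup}_{(s,l)\in\mathrm{dom}\,u\setminus\Phi(u),\,(s,l)\le(t,k)}|u(s,l)|,\ \sup_{(s,l)\in\Phi(u),\,(s,l)\le(t,k)}|u(s,l)|\Big\};$$ for $t+k\to\infty$ this is denoted $\|u\|_\infty$. Solutions. For subsystem $i$ the input is $v_i=(x_1^T,\dots,x_{i-1}^T,x_{i+1}^T,\dots,x_n^T,u^T)^T$, made of hybrid inputs $x_j:\mathrm{dom}\,x_j\to\chi_j$ ($j\ne i$) and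 $u:\mathrm{dom}\,u\to U$. A pair $(x_i,v_i)$ with $x_i$ a hybrid arc with values in $\chi_i$ is a solution pair of subsystem $i$ if: (i) $\mathrm{dom}\,x_i=\mathrm{dom}\,u=\mathrm{dom}\,x_j$ for $j\ne i$, and $(x(0,0),u(0,0))\in C_i\cup D_i$; (ii) for all $k\in\mathbb{N}_+$ and almost all $t$ with $(t,k)\in\mathrm{dom}\,x_i$: $(x(t,k),u(t,k))\in C_i$ and $\dot x_i(t,k)=f_i(x(t,k),u(t,k))$; (iii) for all $(t,k)\in\mathrm{dom}\,x_i$ with $(t,k+1)\in\mathrm{dom}\,x_i$: $(x(t,k),u(t,k))\in D_i$ and $x_i(t,k+1)=g_i(x(t,k),u(t,k))$. Solution pairs $(x,u)$ of the overall system are defined in the same way with $f,g,C,D$. A solution pair is maximal if it cannot be extended, and complete if its hybrid time domain is unbounded. $S_{v_i}(x_{i0})$ (resp. $S_u(x_0)$) is the set of maximal solution pairs of subsystem $i$ (resp. of the overall system) with $x_i(0,0)=x_{i0}$ (resp. $x(0,0)=x_0$). AG property. Subsystem $i$ has the asymptotic gain property (AG) if there exist $\tilde\gamma_{ij},\tilde\gamma_i\in\mathcal{K}_\infty\cup\{0\}$ such that for all initial values $x_{i0}$ all solution pairs $(x_i,v_i)\in S_{v_i}(x_{i0})$ are bounded and, if complete, satisfy $$\limsup_{(t,k)\in\mathrm{dom}\,x_i,\ t+k\to\infty}|x_i(t,k)|\le\max\{\max_{j\ne i}\tilde\gamma_{ij}(\|x_j\|_\infty),\tilde\gamma_i(\|u\|_\infty)\}.$$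 The overall system has the AG property if there is $\tilde\gamma\in\mathcal{K}_\infty\cup\{0\}$ such that for all $x_0$ all solution pairs $(x,u)\in S_u(x_0)$ are bounded and, if complete, satisfy $\limsup_{(t,k)\in\mathrm{dom}\,x,\,t+k\to\infty}|x(t,k)|\le\tilde\gamma(\|u\|_\infty)$. *)

theory Defs
  imports "HOL-Analysis.Analysis" "HOL-Probability.Essential_Supremum"
begin

section \<open>Comparison functions\<close>

text \<open>Functions on the nonnegative half-line are total functions on the reals
  of which only the restriction to \<open>{0..}\<close> is ever used.\<close>

definition class_K :: "(real \<Rightarrow> real) \<Rightarrow> bool" where
  "class_K \<gamma> \<longleftrightarrow> continuous_on {0..} \<gamma> \<and> strict_mono_on {0..} \<gamma> \<and> \<gamma> 0 = 0"

definition class_Kinf :: "(real \<Rightarrow> real) \<Rightarrow> bool" where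
  "class_Kinf \<gamma> \<longleftrightarrow> class_K \<gamma> \<and> (\<forall>B. \<exists>s\<ge>0. \<gamma> s > B)"

definition gain :: "(real \<Rightarrow> real) \<Rightarrow> bool" where
  "gain \<gamma> \<longleftrightarrow> class_Kinf \<gamma> \<or> (\<forall>s\<ge>0. \<gamma> s = 0)"

text \<open>Signal norms may be infinite; a gain is extended to \<open>\<infinity>\<close> by its limit, which is
  \<open>\<infinity>\<close> for a gain of class \<open>K\<^sub>\<infinity>\<close> and \<open>0\<close> for the zero gain.\<close>

definition gain_ext :: "(real \<Rightarrow> real) \<Rightarrow> ereal \<Rightarrow> ereal" where
  "gain_ext \<gamma> r =
     (if r = \<infinity> then (SUP s\<in>{0..}. ereal (\<gamma> s)) else ereal (\<gamma> (real_of_ereal r)))"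

section \<open>Hybrid time domains and hybrid signals\<close>

definition hybrid_time_domain :: "(real \<times> nat) set \<Rightarrow> bool" where
  "hybrid_time_domain E \<longleftrightarrow>
     (\<exists>\<tau> :: nat \<Rightarrow> real. \<tau> 0 = 0 \<and> (\<forall>k. \<tau> k \<le> \<tau> (Suc k)) \<and>
        E = (\<Union>k. {\<tau> k..\<tau> (Suc k)} \<times> {k})) \<or>
     (\<exists>(\<tau> :: nat \<Rightarrow> real) K I. \<tau> 0 = 0 \<and> (\<forall>k<K. \<tau> k \<le> \<tau> (Suc k)) \<and>
        ((\<exists>T\<ge>\<tau> K. I = {\<tau> K..T}) \<or> (\<exists>T>\<tau> K. I = {\<tau> K..<T}) \<or> I = {\<tau> K..}) \<and>
        E = (\<Union>k<K. {\<tau> k..\<tau> (Suc k)} \<times> {k}) \<union> I \<times> {K})"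

definition slice :: "(real \<times> nat) set \<Rightarrow> nat \<Rightarrow> real set" where
  "slice E k = {t. (t, k) \<in> E}"

text \<open>A hybrid signal is given by its domain \<open>E\<close> together with a total function
  of which only the restriction to \<open>E\<close> matters.\<close>

definition hybrid_input :: "(real \<times> nat) set \<Rightarrow> (real \<times> nat \<Rightarrow> 'a::euclidean_space) \<Rightarrow> bool" where
  "hybrid_input E u \<longleftrightarrow> hybrid_time_domain E \<and>
     (\<forall>k. (\<lambda>t. u (t, k)) \<in> borel_measurable (lebesgue_on (slice E k)) \<and>
          (\<forall>S. compact S \<and> S \<subseteq> slice E k \<longrightarrow>
             (\<exists>B. AE t in lebesgue_on S. norm (u (t, k)) \<le> B)))"

definition abs_continuous_on :: "real set \<Rightarrow> (real \<Rightarrow> 'a::real_normed_vector) \<Rightarrow> bool" where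
  "abs_continuous_on S h \<longleftrightarrow>
     (\<forall>\<epsilon>>0. \<exists>\<delta>>0. \<forall>P. finite P \<and> (\<forall>(a, b)\<in>P. a \<le> b \<and> {a..b} \<subseteq> S) \<and>
          disjoint_family_on (\<lambda>(a, b). {a<..<b}) P \<and> (\<Sum>(a, b)\<in>P. b - a) < \<delta> \<longrightarrow>
          (\<Sum>(a, b)\<in>P. norm (h b - h a)) < \<epsilon>)"

definition hybrid_arc :: "(real \<times> nat) set \<Rightarrow> (real \<times> nat \<Rightarrow> 'a::euclidean_space) \<Rightarrow> bool" where
  "hybrid_arc E x \<longleftrightarrow> hybrid_time_domain E \<and>
     (\<forall>k a b. {a..b} \<subseteq> slice E k \<longrightarrow> abs_continuous_on {a..b} (\<lambda>t. x (t, k)))"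

definition jump_times :: "(real \<times> nat) set \<Rightarrow> (real \<times> nat) set" where
  "jump_times E = {(s, l). (s, l) \<in> E \<and> (s, Suc l) \<in> E}"

definition hybrid_upto :: "real \<times> nat \<Rightarrow> (real \<times> nat) set" where
  "hybrid_upto p = {(s, l). s + real l \<le> fst p + real (snd p)}"

text \<open>The essential supremum refers to Lebesgue measure on each slice. The element \<open>0\<close> only
  fixes the value for suprema over empty or null sets.\<close>

definition hybrid_norm_upto ::
    "(real \<times> nat) set \<Rightarrow> (real \<times> nat \<Rightarrow> 'a::euclidean_space) \<Rightarrow> real \<times> nat \<Rightarrow> ereal" where
  "hybrid_norm_upto E u p =
     Sup {0,
          SUP l. esssup (lebesgue_on (slice ((E - jump_times E) \<inter> hybrid_upto p) l))
                        (\<lambda>s. ereal (norm (u (s, l)))),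
          SUP q\<in>jump_times E \<inter> hybrid_upto p. ereal (norm (u q))}"

text \<open>The norm up to \<open>(t, k)\<close> is nondecreasing in \<open>t + k\<close>, so its limit is a supremum.\<close>

definition hybrid_norm ::
    "(real \<times> nat) set \<Rightarrow> (real \<times> nat \<Rightarrow> 'a::euclidean_space) \<Rightarrow> ereal" where
  "hybrid_norm E u = (SUP p\<in>E. hybrid_norm_upto E u p)"

definition hybrid_at_top :: "(real \<times> nat) set \<Rightarrow> (real \<times> nat) filter" where
  "hybrid_at_top E = inf (filtercomap (\<lambda>(t, k). t + real k) at_top) (principal E)"

definition complete_domain :: "(real \<times> nat) set \<Rightarrow> bool" where
  "complete_domain E \<longleftrightarrow> \<not> (\<exists>B. \<forall>(t, k)\<in>E. t + real k \<le> B)"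

section \<open>Interconnected hybrid systems\<close>

text \<open>The subsystems are indexed by the finite type \<open>'n\<close>. As their state dimensions may differ,
  the state space of subsystem \<open>i\<close> is the space \<open>coord_space (coords H i)\<close> of
  vectors supported on a set of \<open>N\<^sub>i = card (coords H i)\<close> coordinates of \<open>real^'m\<close>.
  The overall state is an element of \<open>real^'m^'n\<close> with components \<open>x $ i\<close>; its norm
  is the Euclidean norm of the concatenated vector.\<close>

definition coord_space :: "'m set \<Rightarrow> (real^'m) set" where
  "coord_space J = {v. \<forall>c. c \<notin> J \<longrightarrow> v $ c = 0}"

record ('n, 'm, 'p) hybrid_network =
  coords :: "'n \<Rightarrow> 'm set"
  states :: "'n \<Rightarrow> (real^'m) set"
  inputs :: "(real^'p) set"
  flow_set :: "'n \<Rightarrow> ((real^'m^'n) \<times> (real^'p)) set"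
  jump_set :: "'n \<Rightarrow> ((real^'m^'n) \<times> (real^'p)) set"
  flow_map :: "'n \<Rightarrow> (real^'m^'n) \<times> (real^'p) \<Rightarrow> real^'m"
  jump_map :: "'n \<Rightarrow> (real^'m^'n) \<times> (real^'p) \<Rightarrow> real^'m"

definition overall_states :: "('n::finite, 'm::finite, 'p::finite) hybrid_network \<Rightarrow> (real^'m^'n) set" where
  "overall_states H = {x. \<forall>i. x $ i \<in> states H i}"

definition interconnection :: "('n::finite, 'm::finite, 'p::finite) hybrid_network \<Rightarrow> bool" where
  "interconnection H \<longleftrightarrow>
     closed (inputs H) \<and>
     (\<forall>i. openin (top_of_set (coord_space (coords H i))) (states H i) \<and>
          closedin (top_of_set (overall_states H \<times> inputs H)) (flow_set H i) \<and>
          closedin (top_of_set (overall_states H \<times> inputs H)) (jump_set H i) \<and>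
          continuous_on (flow_set H i) (flow_map H i) \<and>
          flow_map H i ` flow_set H i \<subseteq> coord_space (coords H i) \<and>
          continuous_on (jump_set H i) (jump_map H i) \<and>
          jump_map H i ` jump_set H i \<subseteq> states H i)"

definition overall_flow_set ::
    "('n::finite, 'm::finite, 'p::finite) hybrid_network \<Rightarrow> ((real^'m^'n) \<times> (real^'p)) set" where
  "overall_flow_set H = (\<Inter>i. flow_set H i)"

definition overall_jump_set ::
    "('n::finite, 'm::finite, 'p::finite) hybrid_network \<Rightarrow> ((real^'m^'n) \<times> (real^'p)) set" where
  "overall_jump_set H = (\<Union>i. jump_set H i)"

definition overall_flow_map ::
    "('n::finite, 'm::finite, 'p::finite) hybrid_network \<Rightarrow> (real^'m^'n) \<times> (real^'p) \<Rightarrow> real^'m^'n" where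
  "overall_flow_map H z = (\<chi> i. flow_map H i z)"

definition overall_jump_map ::
    "('n::finite, 'm::finite, 'p::finite) hybrid_network \<Rightarrow> (real^'m^'n) \<times> (real^'p) \<Rightarrow> real^'m^'n" where
  "overall_jump_map H z = (\<chi> i. if z \<in> jump_set H i then jump_map H i z else fst z $ i)"

subsection \<open>Solution pairs\<close>

text \<open>A solution pair \<open>(x\<^sub>i, v\<^sub>i)\<close> of subsystem \<open>i\<close> is represented by the common domain \<open>E\<close>, the
  signal \<open>x\<close> collecting the arc \<open>x\<^sub>i\<close> and the inputs \<open>x\<^sub>j\<close> for \<open>j \<noteq> i\<close>, and the external
  input \<open>u\<close>.\<close>

definition subsystem_solution ::
    "('n::finite, 'm::finite, 'p::finite) hybrid_network \<Rightarrow> 'n \<Rightarrow>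
     (real \<times> nat) set \<Rightarrow> (real \<times> nat \<Rightarrow> real^'m^'n) \<Rightarrow> (real \<times> nat \<Rightarrow> real^'p) \<Rightarrow> bool" where
  "subsystem_solution H i E x u \<longleftrightarrow>
     hybrid_arc E (\<lambda>p. x p $ i) \<and> (\<forall>j. j \<noteq> i \<longrightarrow> hybrid_input E (\<lambda>p. x p $ j)) \<and>
     hybrid_input E u \<and>
     (\<forall>p\<in>E. x p \<in> overall_states H \<and> u p \<in> inputs H) \<and>
     (x (0, 0), u (0, 0)) \<in> flow_set H i \<union> jump_set H i \<and>
     (\<forall>k. AE t in lebesgue. (t, k) \<in> E \<longrightarrow>
        (x (t, k), u (t, k)) \<in> flow_set H i \<and>
        ((\<lambda>s. x (s, k) $ i) has_vector_derivative flow_map H i (x (t, k), u (t, k)))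
          (at t within slice E k)) \<and>
     (\<forall>t k. (t, k) \<in> E \<and> (t, Suc k) \<in> E \<longrightarrow>
        (x (t, k), u (t, k)) \<in> jump_set H i \<and>
        x (t, Suc k) $ i = jump_map H i (x (t, k), u (t, k)))"

definition overall_solution ::
    "('n::finite, 'm::finite, 'p::finite) hybrid_network \<Rightarrow>
     (real \<times> nat) set \<Rightarrow> (real \<times> nat \<Rightarrow> real^'m^'n) \<Rightarrow> (real \<times> nat \<Rightarrow> real^'p) \<Rightarrow> bool" where
  "overall_solution H E x u \<longleftrightarrow>
     hybrid_arc E x \<and> hybrid_input E u \<and>
     (\<forall>p\<in>E. x p \<in> overall_states H \<and> u p \<in> inputs H) \<and>
     (x (0, 0), u (0, 0)) \<in> overall_flow_set H \<union> overall_jump_set H \<and>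
     (\<forall>k. AE t in lebesgue. (t, k) \<in> E \<longrightarrow>
        (x (t, k), u (t, k)) \<in> overall_flow_set H \<and>
        ((\<lambda>s. x (s, k)) has_vector_derivative overall_flow_map H (x (t, k), u (t, k)))
          (at t within slice E k)) \<and>
     (\<forall>t k. (t, k) \<in> E \<and> (t, Suc k) \<in> E \<longrightarrow>
        (x (t, k), u (t, k)) \<in> overall_jump_set H \<and>
        x (t, Suc k) = overall_jump_map H (x (t, k), u (t, k)))"

definition maximal_pair ::
    "((real \<times> nat) set \<Rightarrow> (real \<times> nat \<Rightarrow> 'a) \<Rightarrow> (real \<times> nat \<Rightarrow> 'b) \<Rightarrow> bool) \<Rightarrow>
     (real \<times> nat) set \<Rightarrow> (real \<times> nat \<Rightarrow> 'a) \<Rightarrow> (real \<times> nat \<Rightarrow> 'b) \<Rightarrow> bool" where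
  "maximal_pair sol E x u \<longleftrightarrow> sol E x u \<and>
     \<not> (\<exists>E' x' u'. sol E' x' u' \<and> E \<subset> E' \<and> (\<forall>p\<in>E. x' p = x p \<and> u' p = u p))"

subsection \<open>Asymptotic gain property\<close>

text \<open>Boundedness of a solution pair means boundedness of its state. Quantifying over all
  maximal solution pairs covers all initial values.\<close>

definition subsystem_AG ::
    "('n::finite, 'm::finite, 'p::finite) hybrid_network \<Rightarrow> 'n \<Rightarrow>
     ('n \<Rightarrow> real \<Rightarrow> real) \<Rightarrow> (real \<Rightarrow> real) \<Rightarrow> bool" where
  "subsystem_AG H i \<gamma> \<gamma>\<^sub>u \<longleftrightarrow>
     (\<forall>j. j \<noteq> i \<longrightarrow> gain (\<gamma> j)) \<and> gain \<gamma>\<^sub>u \<and>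
     (\<forall>E x u. maximal_pair (subsystem_solution H i) E x u \<longrightarrow>
        bounded ((\<lambda>p. x p $ i) ` E) \<and>
        (complete_domain E \<longrightarrow>
           Limsup (hybrid_at_top E) (\<lambda>p. ereal (norm (x p $ i)))
           \<le> max (Max ((\<lambda>j. gain_ext (\<gamma> j) (hybrid_norm E (\<lambda>p. x p $ j))) ` {j. j \<noteq> i}))
                 (gain_ext \<gamma>\<^sub>u (hybrid_norm E u))))"

definition overall_AG :: "('n::finite, 'm::finite, 'p::finite) hybrid_network \<Rightarrow> bool" where
  "overall_AG H \<longleftrightarrow>
     (\<exists>\<gamma>. gain \<gamma> \<and>
       (\<forall>E x u. maximal_pair (overall_solution H) E x u \<longrightarrow>
          bounded (x ` E) \<and>
          (complete_domain E \<longrightarrow>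
             Limsup (hybrid_at_top E) (\<lambda>p. ereal (norm (x p)))
             \<le> gain_ext \<gamma> (hybrid_norm E u))))"

definition gain_matrix :: "('n \<Rightarrow> 'n \<Rightarrow> real \<Rightarrow> real) \<Rightarrow> 'n \<Rightarrow> 'n \<Rightarrow> real \<Rightarrow> real" where
  "gain_matrix \<gamma> i j = (if i = j then (\<lambda>_. 0) else \<gamma> i j)"

definition Gamma_max :: "('n \<Rightarrow> 'n \<Rightarrow> real \<Rightarrow> real) \<Rightarrow> real^'n \<Rightarrow> real^('n::finite)" where
  "Gamma_max \<gamma> s = (\<chi> i. Max ((\<lambda>j. \<gamma> i j (s $ j)) ` {j. j \<noteq> i}))"

end

theory Submission
  imports Defs
begin

text \<open>A complete solution of the overall system can be restarted at arbitrarily late hybrid times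
  \<open>(t\<^sub>0, k\<^sub>0)\<close>, and since all \<open>D\<^sub>i\<close> coincide, each restarted solution is a complete, hence maximal,
  solution of every subsystem. The asymptotic gain property then bounds
  \<open>s\<^sub>i = limsup |x\<^sub>i|\<close> in terms of the suprema of the other \<open>|x\<^sub>j|\<close> after \<open>(t\<^sub>0, k\<^sub>0)\<close>, and letting
  \<open>t\<^sub>0 + k\<^sub>0\<close> tend to infinity gives \<open>s\<^sub>i \<le> max (max\<^sub>j \<gamma>\<^sub>i\<^sub>j(s\<^sub>j)) (\<gamma>\<^sub>i(|u|))\<close>. Iterating this
  inequality \<open>n\<close> times bounds \<open>s\<close> by a gain of \<open>|u|\<close>: otherwise some nonempty set of
  indices would satisfy \<open>s \<le> \<Gamma>(s)\<close> after setting the remaining entries to zero.\<close>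

section \<open>Small gain\<close>

text \<open>A common weakening of class K-infinity and the zero gain, so that sums and compositions
  of gains avoid case distinctions. Strictness and unboundedness are restored at the very end by
  adding the identity.\<close>

definition monotone_gain :: "(real \<Rightarrow> real) \<Rightarrow> bool" where
  "monotone_gain g \<longleftrightarrow> continuous_on {0..} g \<and> mono_on {0..} g \<and> g 0 = 0"

lemma monotone_gain_mono: "monotone_gain g \<Longrightarrow> 0 \<le> a \<Longrightarrow> a \<le> b \<Longrightarrow> g a \<le> g b"
  by (auto simp: monotone_gain_def mono_on_def)

lemma monotone_gain_nonneg: "monotone_gain g \<Longrightarrow> 0 \<le> a \<Longrightarrow> 0 \<le> g a"
  using monotone_gain_mono[of g 0 a] by (simp add: monotone_gain_def)

lemma gain_imp_monotone_gain:
  assumes "gain g"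
  shows "monotone_gain g"
proof (cases "class_Kinf g")
  case True
  then show ?thesis
    by (auto simp: class_Kinf_def class_K_def monotone_gain_def intro: strict_mono_on_imp_mono_on)
next
  case False
  with assms have 0: "g s = 0" if "s \<ge> 0" for s
    using that by (auto simp: gain_def)
  then have "continuous_on {0..} g"
    by (subst continuous_on_cong[where g = "\<lambda>_. 0"]) auto
  with 0 show ?thesis
    by (auto simp: monotone_gain_def mono_on_def)
qed

lemma monotone_gain_add:
  "monotone_gain f \<Longrightarrow> monotone_gain g \<Longrightarrow> monotone_gain (\<lambda>r. f r + g r)"
  by (auto simp: monotone_gain_def mono_on_def intro!: continuous_on_add add_mono)

lemma monotone_gain_sum:
  "(\<And>i. i \<in> I \<Longrightarrow> monotone_gain (f i)) \<Longrightarrow> monotone_gain (\<lambda>r. \<Sum>i\<in>I. f i r)"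
  by (auto simp: monotone_gain_def mono_on_def intro!: continuous_on_sum sum_mono sum.neutral)

lemma monotone_gain_compose:
  assumes "monotone_gain f" "monotone_gain g"
  shows "monotone_gain (\<lambda>r. f (g r))"
proof -
  have "continuous_on {0..} (\<lambda>r. f (g r))"
    using assms by (intro continuous_on_compose2[of "{0..}" f "{0..}" g])
      (auto simp: monotone_gain_def dest: monotone_gain_nonneg[OF assms(2)])
  moreover have "mono_on {0..} (\<lambda>r. f (g r))"
    using monotone_gain_mono[OF assms(1) monotone_gain_nonneg[OF assms(2)] monotone_gain_mono[OF assms(2)]]
    by (simp add: mono_on_def)
  ultimately show ?thesis
    using assms by (simp add: monotone_gain_def)
qed

text \<open>Turns a sum of iterated gains, which may vanish or be bounded, into a genuine gain while
  only enlarging it: the identity supplies both strict growth and unboundedness.\<close>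

lemma class_Kinf_id_add:
  assumes "monotone_gain g"
  shows "class_Kinf (\<lambda>r. r + g r)"
proof -
  have "strict_mono_on {0..} (\<lambda>r. r + g r)"
    using monotone_gain_mono[OF assms]
    by (intro strict_mono_onI add_less_le_mono) auto
  moreover have "\<exists>s\<ge>0. s + g s > B" for B
    using monotone_gain_nonneg[OF assms, of "\<bar>B\<bar> + 1"] by (intro exI[of _ "\<bar>B\<bar> + 1"]) auto
  ultimately show ?thesis
    using assms by (auto simp: class_Kinf_def class_K_def monotone_gain_def intro!: continuous_on_add)
qed

text \<open>Sums instead of maxima keep the iterates continuous and still dominate every
  admissible \<open>s\<close> in the small-gain argument.\<close>

primrec gain_iterate ::
    "('n::finite \<Rightarrow> 'n \<Rightarrow> real \<Rightarrow> real) \<Rightarrow> ('n \<Rightarrow> real \<Rightarrow> real) \<Rightarrow> nat \<Rightarrow> 'n \<Rightarrow> real \<Rightarrow> real" where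
  "gain_iterate g v 0 i r = v i r"
| "gain_iterate g v (Suc m) i r = v i r + (\<Sum>j | j \<noteq> i. g i j (gain_iterate g v m j r))"

lemma monotone_gain_iterate:
  assumes g: "\<And>i j. j \<noteq> i \<Longrightarrow> monotone_gain (g i j)"
    and v: "\<And>i. monotone_gain (v i)"
  shows "monotone_gain (gain_iterate g v m i)"
proof (induction m arbitrary: i)
  case 0
  then show ?case using v[of i] by (simp add: monotone_gain_def)
next
  case (Suc m)
  have "monotone_gain (\<lambda>r. v i r + (\<Sum>j | j \<noteq> i. g i j (gain_iterate g v m j r)))"
    by (rule monotone_gain_add[OF v monotone_gain_sum[OF monotone_gain_compose[OF g Suc]]]) simp
  then show ?case
    by (simp add: monotone_gain_def)
qed

text \<open>Makes the exceptional sets \<open>A m\<close> of the small-gain argument nested. The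
  first step only adds nonnegative summands, and monotonicity of the \<open>g i j\<close> propagates
  the inequality.\<close>

lemma gain_iterate_Suc_ge:
  assumes g: "\<And>i j. j \<noteq> i \<Longrightarrow> monotone_gain (g i j)"
    and v: "\<And>i. monotone_gain (v i)" and r: "0 \<le> r"
  shows "gain_iterate g v m i r \<le> gain_iterate g v (Suc m) i r"
proof (induction m arbitrary: i)
  case 0
  have "0 \<le> g i j (v j r)" if "j \<noteq> i" for j
    using monotone_gain_nonneg[OF g[OF that] monotone_gain_nonneg[OF v r]] .
  then show ?case
    by (auto intro!: sum_nonneg)
next
  case (Suc m)
  have "0 \<le> gain_iterate g v m j r" for j
    using monotone_gain_nonneg[OF monotone_gain_iterate[where g = g and v = v, OF g v] r] .
  then have "g i j (gain_iterate g v m j r) \<le> g i j (gain_iterate g v (Suc m) j r)" if "j \<noteq> i" for j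
    using monotone_gain_mono[OF g[OF that] _ Suc] by blast
  then have "(\<Sum>j | j \<noteq> i. g i j (gain_iterate g v m j r))
      \<le> (\<Sum>j | j \<noteq> i. g i j (gain_iterate g v (Suc m) j r))"
    by (intro sum_mono) simp
  then show ?case
    by simp
qed

text \<open>Let \<open>A m\<close> be the set of indices where \<open>s\<close> exceeds the
  \<open>m\<close>-th iterate. Each index of \<open>A (Suc m)\<close> is dominated through
  \<open>g\<close> by an index of \<open>A m\<close>. If a nonempty \<open>A m\<close> did not
  shrink, \<open>s\<close> cut off outside it would contradict \<open>small\<close>. So the sets
  shrink strictly until they are empty, which takes at most as many steps as there are
  indices.\<close>

lemma small_gain_bound:
  fixes g :: "'n::finite \<Rightarrow> 'n \<Rightarrow> real \<Rightarrow> real" and s :: "'n \<Rightarrow> real"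
  assumes card: "CARD('n) \<ge> 2"
    and g: "\<And>i j. j \<noteq> i \<Longrightarrow> monotone_gain (g i j)"
    and v: "\<And>i. monotone_gain (v i)"
    and small: "\<And>s :: real^'n. 0 \<le> s \<Longrightarrow> s \<noteq> 0 \<Longrightarrow> \<not> s \<le> Gamma_max (gain_matrix g) s"
    and r: "0 \<le> r" and s: "\<And>i. 0 \<le> s i"
    and dom: "\<And>i. s i \<le> v i r \<or> (\<exists>j. j \<noteq> i \<and> s i \<le> g i j (s j))"
  shows "s i \<le> gain_iterate g v CARD('n) i r"
proof -
  define B where "B m i = gain_iterate g v m i r" for m i
  define A where "A m = {i. B m i < s i}" for m
  have B0: "0 \<le> B m j" for m j
    unfolding B_def
    using monotone_gain_nonneg[OF monotone_gain_iterate[where g = g and v = v, OF g v] r] .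
  have BS: "B (Suc m) i = v i r + (\<Sum>j | j \<noteq> i. g i j (B m j))" for m i
    by (simp add: B_def)
  have decr: "A (Suc m) \<subseteq> A m" for m
  proof
    fix i
    assume "i \<in> A (Suc m)"
    moreover have "B m i \<le> B (Suc m) i"
      unfolding B_def by (rule gain_iterate_Suc_ge[where g = g and v = v, OF g v r])
    ultimately show "i \<in> A m"
      by (auto simp: A_def)
  qed
  \<comment> \<open>For such \<open>i\<close>, \<open>s i\<close> exceeds both \<open>v i r\<close>
    and every single summand \<open>g i j (B m j)\<close>. The first fact forces the second
    alternative of \<open>dom\<close>; the second one and monotonicity of \<open>g i j\<close> then
    force \<open>B m j < s j\<close>.\<close>
  have succ: "\<exists>j. j \<noteq> i \<and> j \<in> A m \<and> s i \<le> g i j (s j)" if "i \<in> A (Suc m)" for i m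
  proof -
    have gn: "0 \<le> g i j (B m j)" if "j \<noteq> i" for j
      using monotone_gain_nonneg[OF g[OF that] B0] .
    have lt: "v i r + (\<Sum>j | j \<noteq> i. g i j (B m j)) < s i"
      using that by (simp add: A_def BS)
    moreover have "0 \<le> (\<Sum>j | j \<noteq> i. g i j (B m j))"
      using gn by (intro sum_nonneg) auto
    ultimately have "v i r < s i" by linarith
    with dom[of i] obtain j where j: "j \<noteq> i" "s i \<le> g i j (s j)" by auto
    have "g i j (B m j) \<le> (\<Sum>j | j \<noteq> i. g i j (B m j))"
      using j gn by (intro member_le_sum) auto
    moreover have "0 \<le> v i r"
      using v r by (rule monotone_gain_nonneg)
    ultimately have "g i j (B m j) < g i j (s j)"
      using lt j by linarith
    then have "B m j < s j"
      using monotone_gain_mono[OF g[OF j(1)] s, of j "B m j"] by (meson not_le)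
    with j show ?thesis by (auto simp: A_def)
  qed
  have neq: "A (Suc m) \<noteq> A m" if ne: "A m \<noteq> {}" for m
  proof
    assume eq: "A (Suc m) = A m"
    \<comment> \<open>The dominating index supplied by \<open>succ\<close> lies in
      \<open>A m\<close> itself, so cutting \<open>s\<close> off outside \<open>A m\<close>
      preserves every inequality for indices inside.\<close>
    define w :: "real^'n" where "w = (\<chi> i. if i \<in> A m then s i else 0)"
    have w0: "0 \<le> w"
      using s by (auto simp: w_def less_eq_vec_def)
    obtain i where i: "i \<in> A m" using ne by auto
    have "0 < w $ i"
      using i B0[of m i] by (simp add: w_def) (simp add: A_def)
    then have "w \<noteq> 0" by auto
    moreover have "w $ i \<le> Gamma_max (gain_matrix g) w $ i" for i
    proof -
      have ge: "g i j (w $ j) \<le> Gamma_max (gain_matrix g) w $ i" if "j \<noteq> i" for j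
        using that by (auto simp: Gamma_max_def gain_matrix_def intro!: Max_ge)
      show ?thesis
      proof (cases "i \<in> A m")
        case True
        then obtain j where "j \<noteq> i" "j \<in> A m" "s i \<le> g i j (s j)"
          using succ[of i m] eq by auto
        with ge[of j] True show ?thesis by (simp add: w_def)
      next
        case False
        \<comment> \<open>Outside \<open>A m\<close> the entry of \<open>w\<close> is 0, and it
          suffices that the maximum is nonnegative. This is where at least two subsystems are used:
          the maximum must range over a nonempty set.\<close>
        have "\<exists>j. j \<noteq> i"
        proof (rule ccontr)
          assume "\<nexists>j. j \<noteq> i"
          then have "(UNIV :: 'n set) = {i}" by auto
          then have "CARD('n) = card {i}" by (simp only:)
          with card show False by simp
        qed
        then obtain j where j: "j \<noteq> i" ..
        have "0 \<le> g i j (w $ j)"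
          using monotone_gain_nonneg[OF g[OF j]] w0 by (simp add: less_eq_vec_def)
        with ge[OF j] False show ?thesis by (simp add: w_def)
      qed
    qed
    ultimately show False
      using small[OF w0] by (auto simp: less_eq_vec_def)
  qed
  \<comment> \<open>Subtraction is truncated, which matches the two cases: an empty set stays empty,
    and a nonempty one loses an element.\<close>
  have "card (A m) \<le> CARD('n) - m" for m
  proof (induction m)
    case 0
    show ?case by (simp add: card_mono)
  next
    case (Suc m)
    show ?case
    proof (cases "A m = {}")
      case True
      with decr[of m] show ?thesis by simp
    next
      case False
      with decr[of m] neq[of m] have "card (A (Suc m)) < card (A m)"
        by (intro psubset_card_mono) auto
      with Suc show ?thesis by linarith
    qed
  qed
  from this[of "CARD('n)"] have "A CARD('n) = {}" by simp
  then show ?thesis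
    by (force simp: A_def B_def not_less)
qed

section \<open>Hybrid time domains and their shifts\<close>

text \<open>In the finite case the definition constrains \<open>\<tau>\<close> only up to
  \<open>K\<close>. Freezing it after \<open>K\<close> leaves the domain unchanged and makes it
  monotone on all indices, so both cases can be treated by \<open>monoD\<close>.\<close>

lemma hybrid_time_domain_cases:
  assumes "hybrid_time_domain E"
  obtains (infinite) \<tau> where "mono \<tau>" "\<tau> 0 = (0::real)"
      "E = (\<Union>k. {\<tau> k..\<tau> (Suc k)} \<times> {k})"
    | (finite) \<tau> K I where "mono \<tau>" "\<tau> 0 = (0::real)"
      "(\<exists>T\<ge>\<tau> K. I = {\<tau> K..T}) \<or> (\<exists>T>\<tau> K. I = {\<tau> K..<T}) \<or> I = {\<tau> K..}"
      "E = (\<Union>k<K. {\<tau> k..\<tau> (Suc k)} \<times> {k}) \<union> I \<times> {K}"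
  using assms unfolding hybrid_time_domain_def
proof (elim disjE exE)
  fix \<tau> :: "nat \<Rightarrow> real"
  assume "\<tau> 0 = 0 \<and> (\<forall>k. \<tau> k \<le> \<tau> (Suc k)) \<and> E = (\<Union>k. {\<tau> k..\<tau> (Suc k)} \<times> {k})"
  then show thesis
    by (intro infinite[of \<tau>]) (auto simp: mono_iff_le_Suc)
next
  fix \<tau> :: "nat \<Rightarrow> real" and K I
  assume "\<tau> 0 = 0 \<and> (\<forall>k<K. \<tau> k \<le> \<tau> (Suc k)) \<and>
      ((\<exists>T\<ge>\<tau> K. I = {\<tau> K..T}) \<or> (\<exists>T>\<tau> K. I = {\<tau> K..<T}) \<or> I = {\<tau> K..}) \<and>
      E = (\<Union>k<K. {\<tau> k..\<tau> (Suc k)} \<times> {k}) \<union> I \<times> {K}"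
  then have fin: "\<tau> 0 = 0" "\<forall>k<K. \<tau> k \<le> \<tau> (Suc k)"
      "(\<exists>T\<ge>\<tau> K. I = {\<tau> K..T}) \<or> (\<exists>T>\<tau> K. I = {\<tau> K..<T}) \<or> I = {\<tau> K..}"
      "E = (\<Union>k<K. {\<tau> k..\<tau> (Suc k)} \<times> {k}) \<union> I \<times> {K}"
    by blast+
  define \<sigma> where "\<sigma> k = \<tau> (min k K)" for k
  have "(\<Union>k<K. {\<tau> k..\<tau> (Suc k)} \<times> {k}) = (\<Union>k<K. {\<sigma> k..\<sigma> (Suc k)} \<times> {k})"
    by (intro SUP_cong) (auto simp: \<sigma>_def min_def)
  moreover have "\<sigma> k \<le> \<sigma> (Suc k)" for k
    using fin(2) by (cases "k < K") (auto simp: \<sigma>_def min_def)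
  moreover have "\<sigma> K = \<tau> K" "\<sigma> 0 = 0"
    using fin(1) by (auto simp: \<sigma>_def)
  ultimately show thesis
    using fin(3,4) by (intro finite[of \<sigma> K I]) (simp_all add: mono_iff_le_Suc)
qed

section \<open>Order structure of a hybrid time domain\<close>

context
  fixes E assumes E: "hybrid_time_domain E"
begin

lemma zero_mem_hybrid_time_domain: "(0, 0) \<in> E"
  using E
proof (cases rule: hybrid_time_domain_cases)
  case (infinite \<tau>)
  then show ?thesis using monoD[of \<tau> 0 1] by auto
next
  case (finite \<tau> K I)
  then show ?thesis using monoD[of \<tau> 0 1] by (cases "K = 0") auto
qed

lemma hybrid_time_nonneg: "(t, k) \<in> E \<Longrightarrow> 0 \<le> t"
  using E
proof (cases rule: hybrid_time_domain_cases)
  case (infinite \<tau>)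
  assume "(t, k) \<in> E"
  with infinite monoD[of \<tau> 0 k] show ?thesis by auto
next
  case (finite \<tau> K I)
  assume "(t, k) \<in> E"
  with finite monoD[of \<tau> 0 k] show ?thesis by auto
qed

lemma hybrid_time_mono:
  assumes "(s, l) \<in> E" "(t, k) \<in> E" "l < k"
  shows "s \<le> t"
  using E
proof (cases rule: hybrid_time_domain_cases)
  case (infinite \<tau>)
  with assms monoD[of \<tau> "Suc l" k] show ?thesis by auto
next
  case (finite \<tau> K I)
  with assms monoD[of \<tau> "Suc l" k] show ?thesis by auto
qed

lemma hybrid_time_interval:
  assumes "(s, k) \<in> E" "(t, k) \<in> E" "s \<le> r" "r \<le> t"
  shows "(r, k) \<in> E"
  using E
proof (cases rule: hybrid_time_domain_cases)
  case (infinite \<tau>)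
  with assms show ?thesis by auto
next
  case (finite \<tau> K I)
  with assms show ?thesis by auto
qed

lemma hybrid_jump_exists:
  assumes "(t, l) \<in> E" "k < l"
  shows "\<exists>a. (a, k) \<in> E \<and> (a, Suc k) \<in> E"
  using E
proof (cases rule: hybrid_time_domain_cases)
  case (infinite \<tau>)
  then have "(\<tau> (Suc k), k) \<in> E \<and> (\<tau> (Suc k), Suc k) \<in> E"
    using monoD[of \<tau> k "Suc k"] monoD[of \<tau> "Suc k" "Suc (Suc k)"] by auto
  then show ?thesis ..
next
  case (finite \<tau> K I)
  \<comment> \<open>The end of slice \<open>k\<close> is a jump time. If \<open>Suc k = K\<close>,
    the next slice is \<open>I\<close>, and each of its three forms contains its left end point
    \<open>\<tau> K\<close>.\<close>
  then have "(\<tau> (Suc k), k) \<in> E \<and> (\<tau> (Suc k), Suc k) \<in> E"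
    using assms monoD[of \<tau> k "Suc k"] monoD[of \<tau> "Suc k" "Suc (Suc k)"]
    by (cases "Suc k = K") auto
  then show ?thesis ..
qed

lemma is_interval_slice: "is_interval (slice E k)"
  unfolding is_interval_1 slice_def using hybrid_time_interval by blast

lemma slice_sets_lebesgue: "slice E k \<in> sets lebesgue"
  using real_interval_borel_measurable[OF is_interval_slice] by simp

lemma slice_flow_sets_lebesgue:
  "slice ((E - jump_times E) \<inter> hybrid_upto p) k \<in> sets lebesgue"
proof -
  have "slice ((E - jump_times E) \<inter> hybrid_upto p) k =
      (slice E k - slice E (Suc k)) \<inter> {..fst p + real (snd p) - real k}"
    by (auto simp: slice_def jump_times_def hybrid_upto_def)
  then show ?thesis
    using slice_sets_lebesgue by auto
qed

text \<open>Later slices carry later times, so the two coordinates never move in opposite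
  directions. Comparing \<open>t + k\<close>, as norms and limits do, thus becomes a componentwise
  comparison, and \<open>(t0, k0)\<close> can be subtracted in both coordinates.\<close>

lemma hybrid_time_le:
  assumes "(t0, k0) \<in> E" "(t, k) \<in> E" "t0 + real k0 < t + real k"
  shows "t0 \<le> t \<and> k0 \<le> k"
  using assms hybrid_time_mono[of t0 k0 t k] hybrid_time_mono[of t k t0 k0]
  by (cases k k0 rule: linorder_cases) auto

end

section \<open>Complete domains and maximality\<close>

lemma complete_domainD:
  assumes "complete_domain E"
  shows "\<exists>t k. (t, k) \<in> E \<and> B < t + real k"
proof (rule ccontr)
  assume "\<not> ?thesis"
  then have "\<forall>(t, k)\<in>E. t + real k \<le> B"
    by (auto simp: not_less)
  with assms show False
    unfolding complete_domain_def by blast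
qed

text \<open>A point \<open>(t, k)\<close> of the larger domain lies before some point of
  \<open>E\<close>. Slice \<open>k\<close> of \<open>E\<close> then has a point on either side of
  \<open>t\<close>: on the left the origin or the jump into slice \<open>k\<close>, on the right the
  jump out of it or the chosen later point. Slices are intervals, so \<open>(t, k)\<close> belongs
  to \<open>E\<close>.\<close>

lemma complete_hybrid_domain_unique:
  assumes E: "hybrid_time_domain E" "complete_domain E"
    and E': "hybrid_time_domain E'" "E \<subseteq> E'"
  shows "E = E'"
proof
  show "E' \<subseteq> E"
  proof (rule subrelI)
    fix t k assume tk: "(t, k) \<in> E'"
    obtain s l where sl: "(s, l) \<in> E" "t + real k < s + real l"
      using complete_domainD[OF E(2)] by blast
    have "t \<le> s \<and> k \<le> l"
      using hybrid_time_le[OF E'(1) tk, of s l] sl E'(2) by auto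
    have "\<exists>b. (b, k) \<in> E \<and> b \<le> t"
    proof (cases k)
      case 0
      then show ?thesis
        using zero_mem_hybrid_time_domain[OF E(1)] hybrid_time_nonneg[OF E'(1) tk] by blast
    next
      case (Suc k')
      with \<open>t \<le> s \<and> k \<le> l\<close> have "k' < l" by simp
      then obtain a where "(a, k') \<in> E" "(a, k) \<in> E"
        using hybrid_jump_exists[OF E(1) sl(1), of k'] Suc by auto
      with Suc show ?thesis
        using hybrid_time_mono[OF E'(1) _ tk, of a k'] E'(2) by auto
    qed
    moreover have "\<exists>a. (a, k) \<in> E \<and> t \<le> a"
    proof (cases "k = l")
      case True
      then show ?thesis using sl \<open>t \<le> s \<and> k \<le> l\<close> by auto
    next
      case False
      with \<open>t \<le> s \<and> k \<le> l\<close> obtain a where "(a, k) \<in> E" "(a, Suc k) \<in> E"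
        using hybrid_jump_exists[OF E(1) sl(1), of k] by auto
      then show ?thesis
        using hybrid_time_mono[OF E'(1) tk, of a "Suc k"] E'(2) by auto
    qed
    ultimately show "(t, k) \<in> E"
      using hybrid_time_interval[OF E(1)] by blast
  qed
qed (rule E'(2))

text \<open>The gain properties speak of maximal pairs, whereas a restarted solution is only known
  to be complete. The solution predicate is abstract, as both subsystems and the overall system are
  instances.\<close>

lemma complete_imp_maximal_pair:
  assumes dom: "\<And>E x u. sol E x u \<Longrightarrow> hybrid_time_domain E"
    and sol: "sol E x u" and E: "complete_domain E"
  shows "maximal_pair sol E x u"
  unfolding maximal_pair_def
proof (intro conjI notI sol)
  assume "\<exists>E' x' u'. sol E' x' u' \<and> E \<subset> E' \<and> (\<forall>p\<in>E. x' p = x p \<and> u' p = u p)"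
  then obtain E' x' u' where E': "sol E' x' u'" "E \<subset> E'"
    by blast
  then have "E = E'"
    using complete_hybrid_domain_unique[OF dom[OF sol] E dom[OF E'(1)]] by auto
  with E' show False by auto
qed

text \<open>A preimage under translation, so that the restarted signal is simply
  \<open>\<lambda>p. x (p + p0)\<close>. The sign condition cuts off the part of the starting slice
  that precedes the restart time.\<close>

definition hybrid_shift :: "real \<times> nat \<Rightarrow> (real \<times> nat) set \<Rightarrow> (real \<times> nat) set" where
  "hybrid_shift p0 E = {p. 0 \<le> fst p \<and> p + p0 \<in> E}"

lemma mem_hybrid_shift [simp]:
  "(t, k) \<in> hybrid_shift (t0, k0) E \<longleftrightarrow> 0 \<le> t \<and> (t + t0, k + k0) \<in> E"
  by (simp add: hybrid_shift_def)

lemma hybrid_time_domain_shift: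
  assumes "hybrid_time_domain E" "(t0, k0) \<in> E"
  shows "hybrid_time_domain (hybrid_shift (t0, k0) E)"
  using assms(1)
proof (cases rule: hybrid_time_domain_cases)
  case (infinite \<tau>)
  \<comment> \<open>The starting slice is cut at \<open>t0\<close>, which may lie beyond
    \<open>\<tau> k0\<close>. Hence breakpoint 0 becomes 0, while all later ones are moved by
    \<open>t0\<close>.\<close>
  define \<sigma> where "\<sigma> k = (if k = 0 then 0 else \<tau> (k + k0) - t0)" for k
  have t0: "\<tau> k0 \<le> t0" "t0 \<le> \<tau> (Suc k0)"
    using infinite assms(2) by auto
  have "\<sigma> k \<le> \<sigma> (Suc k)" for k
    using t0 monoD[OF infinite(1), of "k + k0" "Suc (k + k0)"] by (auto simp: \<sigma>_def)
  moreover have "(t, k) \<in> hybrid_shift (t0, k0) E \<longleftrightarrow> (t, k) \<in> (\<Union>k. {\<sigma> k..\<sigma> (Suc k)} \<times> {k})" for t k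
    using t0 monoD[OF infinite(1), of "Suc k0" "k + k0"]
    by (cases "k = 0") (auto simp: \<sigma>_def infinite(3))
  then have "hybrid_shift (t0, k0) E = (\<Union>k. {\<sigma> k..\<sigma> (Suc k)} \<times> {k})"
    unfolding set_eq_iff split_paired_All by blast
  moreover have "\<sigma> 0 = 0"
    by (simp add: \<sigma>_def)
  ultimately show ?thesis
    unfolding hybrid_time_domain_def by blast
next
  case (finite \<tau> K I)
  define \<sigma> where "\<sigma> k = (if k = 0 then 0 else \<tau> (k + k0) - t0)" for k
  define J where "J = {t. 0 \<le> t \<and> t + t0 \<in> I}"
  have k0: "k0 \<le> K"
    using finite(4) assms(2) by auto
  have t0: "\<tau> k0 \<le> t0" "k0 < K \<Longrightarrow> t0 \<le> \<tau> (Suc k0)" "k0 = K \<Longrightarrow> t0 \<in> I"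
    using finite(3,4) assms(2) by auto
  have mono: "\<tau> i \<le> \<tau> j" if "i \<le> j" for i j
    using monoD[OF finite(1) that] .
  have \<sigma>_mono: "\<sigma> k \<le> \<sigma> (Suc k)" if "k < K - k0" for k
    using that t0 mono[of "k + k0" "Suc (k + k0)"] by (auto simp: \<sigma>_def)
  have eq: "(t, k) \<in> hybrid_shift (t0, k0) E \<longleftrightarrow>
      (t, k) \<in> (\<Union>k<K - k0. {\<sigma> k..\<sigma> (Suc k)} \<times> {k}) \<union> J \<times> {K - k0}" for t k
    using t0 k0 mono[of "Suc k0" "k + k0"]
    by (cases "k = 0"; cases "k0 = K") (auto simp: \<sigma>_def J_def finite(4))
  have J: "(\<exists>T\<ge>\<sigma> (K - k0). J = {\<sigma> (K - k0)..T}) \<or> (\<exists>T>\<sigma> (K - k0). J = {\<sigma> (K - k0)..<T})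
      \<or> J = {\<sigma> (K - k0)..}"
  proof -
    \<comment> \<open>The maximum unites two cases: for \<open>k0 < K\<close> the last interval is
      moved as a whole, for \<open>k0 = K\<close> it is cut at \<open>t0\<close>.\<close>
    have \<sigma>: "0 \<le> \<sigma> (K - k0)" "\<sigma> (K - k0) = max 0 (\<tau> K - t0)" 
      using t0 k0 mono[of "Suc k0" K] by (auto simp: \<sigma>_def)
    from finite(3) consider T where "T \<ge> \<tau> K" "I = {\<tau> K..T}" | T where "T > \<tau> K" "I = {\<tau> K..<T}"
      | "I = {\<tau> K..}" by blast
    then show ?thesis
    proof cases
      case 1
      then have "J = {\<sigma> (K - k0)..T - t0}" "\<sigma> (K - k0) \<le> T - t0"
        using \<sigma> t0 k0 mono[of "Suc k0" K] by (cases "k0 = K"; auto simp: J_def)+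
      then show ?thesis by blast
    next
      case 2
      then have "J = {\<sigma> (K - k0)..<T - t0}" "\<sigma> (K - k0) < T - t0"
        using \<sigma> t0 k0 mono[of "Suc k0" K] by (cases "k0 = K"; auto simp: J_def)+
      then show ?thesis by blast
    next
      case 3
      then have "J = {\<sigma> (K - k0)..}"
        using \<sigma> by (auto simp: J_def)
      then show ?thesis by blast
    qed
  qed
  have \<sigma>0: "\<sigma> 0 = 0"
    by (simp add: \<sigma>_def)
  have shift: "hybrid_shift (t0, k0) E = (\<Union>k<K - k0. {\<sigma> k..\<sigma> (Suc k)} \<times> {k}) \<union> J \<times> {K - k0}"
    unfolding set_eq_iff split_paired_All using eq by blast
  show ?thesis
    unfolding hybrid_time_domain_def
    by (rule disjI2, intro exI[of _ \<sigma>] exI[of _ "K - k0"] exI[of _ J] conjI allI impI)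
      (fact \<sigma>0, erule \<sigma>_mono, fact J, fact shift)
qed

lemma complete_domain_shift:
  assumes E: "hybrid_time_domain E" "complete_domain E" and p0: "(t0, k0) \<in> E"
  shows "complete_domain (hybrid_shift (t0, k0) E)"
  unfolding complete_domain_def
proof
  assume "\<exists>B. \<forall>(t, k)\<in>hybrid_shift (t0, k0) E. t + real k \<le> B"
  then obtain B where B: "\<And>t k. (t, k) \<in> hybrid_shift (t0, k0) E \<Longrightarrow> t + real k \<le> B"
    by blast
  \<comment> \<open>The maximum with 0 keeps the point after \<open>(t0, k0)\<close> even for
    negative \<open>B\<close>, so that it comes from a point of the shifted domain.\<close>
  obtain t k where tk: "(t, k) \<in> E" "max B 0 + (t0 + real k0) < t + real k"
    using complete_domainD[OF E(2)] by blast
  then have "t0 \<le> t \<and> k0 \<le> k"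
    using hybrid_time_le[OF E(1) p0 tk(1)] by auto
  with B[of "t - t0" "k - k0"] tk show False
    by (simp add: of_nat_diff)
qed

section \<open>Translation of hybrid arcs\<close>

lemma abs_continuous_on_translate:
  assumes "abs_continuous_on {a + c..b + c} h"
  shows "abs_continuous_on {a..b} (\<lambda>t. h (t + c))"
  unfolding abs_continuous_on_def
proof (intro allI impI)
  fix \<epsilon> :: real assume "\<epsilon> > 0"
  with assms obtain \<delta> where \<delta>: "\<delta> > 0" and
    H: "\<forall>P. finite P \<and> (\<forall>(s, t)\<in>P. s \<le> t \<and> {s..t} \<subseteq> {a + c..b + c}) \<and>
        disjoint_family_on (\<lambda>(s, t). {s<..<t}) P \<and> (\<Sum>(s, t)\<in>P. t - s) < \<delta> \<longrightarrow>
        (\<Sum>(s, t)\<in>P. norm (h t - h s)) < \<epsilon>"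
    unfolding abs_continuous_on_def by blast
  show "\<exists>\<delta>>0. \<forall>P. finite P \<and> (\<forall>(s, t)\<in>P. s \<le> t \<and> {s..t} \<subseteq> {a..b}) \<and>
        disjoint_family_on (\<lambda>(s, t). {s<..<t}) P \<and> (\<Sum>(s, t)\<in>P. t - s) < \<delta> \<longrightarrow>
        (\<Sum>(s, t)\<in>P. norm (h (t + c) - h (s + c))) < \<epsilon>"
  proof (intro exI[of _ \<delta>] conjI allI impI \<delta>)
    fix P :: "(real \<times> real) set"
    assume P: "finite P \<and> (\<forall>(s, t)\<in>P. s \<le> t \<and> {s..t} \<subseteq> {a..b}) \<and>
        disjoint_family_on (\<lambda>(s, t). {s<..<t}) P \<and> (\<Sum>(s, t)\<in>P. t - s) < \<delta>"
    define f where "f = (\<lambda>q :: real \<times> real. (fst q + c, snd q + c))"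
    have inj: "inj_on f P" by (auto simp: f_def inj_on_def prod_eq_iff)
    have "{s + c<..<t + c} \<inter> {s' + c<..<t' + c} = {}"
      if "(s, t) \<in> P" "(s', t') \<in> P" "(s, t) \<noteq> (s', t')" for s t s' t'
    proof -
      have "(case (s, t) of (s, t) \<Rightarrow> {s<..<t}) \<inter> (case (s', t') of (s, t) \<Rightarrow> {s<..<t}) = {}"
        using P that unfolding disjoint_family_on_def by blast
      moreover have "r - c \<in> {s<..<t} \<inter> {s'<..<t'}"
        if "r \<in> {s + c<..<t + c} \<inter> {s' + c<..<t' + c}" for r
        using that by auto
      ultimately show ?thesis by auto
    qed
    then have d1: "disjoint_family_on (\<lambda>(s, t). {s<..<t}) (f ` P)"
      by (auto simp: disjoint_family_on_def f_def)
    have d2: "\<forall>(s, t)\<in>f ` P. s \<le> t \<and> {s..t} \<subseteq> {a + c..b + c}"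
      using P by (auto simp: f_def)
    have d3: "(\<Sum>(s, t)\<in>f ` P. t - s) < \<delta>"
      using P by (simp add: sum.reindex[OF inj] case_prod_beta) (simp add: f_def)
    have "(\<Sum>(s, t)\<in>f ` P. norm (h t - h s)) < \<epsilon>"
      by (rule H[THEN spec, THEN mp]) (intro conjI finite_imageI P[THEN conjunct1] d1 d2 d3)
    then show "(\<Sum>(s, t)\<in>P. norm (h (t + c) - h (s + c))) < \<epsilon>"
      by (simp add: sum.reindex[OF inj] case_prod_beta) (simp add: f_def)
  qed
qed

lemma hybrid_arc_shift:
  assumes "hybrid_arc E x" "(t0, k0) \<in> E"
  shows "hybrid_arc (hybrid_shift (t0, k0) E) (\<lambda>p. x (p + (t0, k0)))"
  unfolding hybrid_arc_def
proof (intro conjI allI impI)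
  show "hybrid_time_domain (hybrid_shift (t0, k0) E)"
    using assms hybrid_time_domain_shift by (auto simp: hybrid_arc_def)
next
  fix k a b
  assume ab: "{a..b} \<subseteq> slice (hybrid_shift (t0, k0) E) k"
  have "{a + t0..b + t0} \<subseteq> slice E (k + k0)"
  proof
    fix t assume "t \<in> {a + t0..b + t0}"
    then have "t - t0 \<in> slice (hybrid_shift (t0, k0) E) k"
      by (intro subsetD[OF ab]) auto
    then show "t \<in> slice E (k + k0)"
      by (simp add: slice_def)
  qed
  then have "abs_continuous_on {a + t0..b + t0} (\<lambda>t. x (t, k + k0))"
    using assms(1) by (auto simp: hybrid_arc_def)
  then show "abs_continuous_on {a..b} (\<lambda>t. x ((t, k) + (t0, k0)))"
    using abs_continuous_on_translate by auto
qed

section \<open>Shifted signals and solutions\<close>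

lemma translation_measurable_lebesgue: "(\<lambda>t::real. t + a) \<in> lebesgue \<rightarrow>\<^sub>M lebesgue"
  using lebesgue_affine_measurable[of "\<lambda>_. 1" a] by (simp add: add.commute)

lemma AE_lebesgue_translation:
  assumes "AE t in lebesgue. P (t :: real)"
  shows "AE t in lebesgue. P (t + a)"
proof -
  have "negligible {t. \<not> P t}"
    using assms by (simp add: eventually_ae_filter_negligible) (meson negligible_subset)
  then have "negligible ((+) (- a) ` {t. \<not> P t})"
    by (rule negligible_translation)
  moreover have "{t. \<not> P (t + a)} \<subseteq> (+) (- a) ` {t. \<not> P t}"
    by (auto intro!: image_eqI[of _ _ "_ + a"])
  ultimately show ?thesis
    by (auto simp: eventually_ae_filter_negligible)
qed

lemma borel_measurable_translation_lebesgue_on: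
  fixes f :: "real \<Rightarrow> 'a::topological_space"
  assumes "f \<in> borel_measurable (lebesgue_on S)" "\<And>t. t \<in> T \<Longrightarrow> t + a \<in> S"
  shows "(\<lambda>t. f (t + a)) \<in> borel_measurable (lebesgue_on T)"
  by (rule measurable_compose[OF measurable_restrict_space3[OF translation_measurable_lebesgue] assms(1)])
    (use assms(2) in auto)

lemma AE_lebesgue_on_translation:
  assumes "AE t in lebesgue_on S. P t" "S \<in> sets lebesgue" "T \<in> sets lebesgue"
    and "\<And>t. t \<in> T \<Longrightarrow> t + a \<in> S"
  shows "AE t in lebesgue_on T. P (t + a :: real)"
proof -
  have "AE t in lebesgue. t \<in> S \<longrightarrow> P t"
    using assms(1,2) by (simp add: AE_restrict_space_iff)
  then have "AE t in lebesgue. t + a \<in> S \<longrightarrow> P (t + a)"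
    by (rule AE_lebesgue_translation)
  then have "AE t in lebesgue. t \<in> T \<longrightarrow> P (t + a)"
    by (rule eventually_mono) (use assms(4) in blast)
  then show ?thesis
    using assms(3) by (simp add: AE_restrict_space_iff)
qed

lemma esssup_translation_le:
  fixes f :: "real \<Rightarrow> ereal"
  assumes "f \<in> borel_measurable (lebesgue_on S)" "S \<in> sets lebesgue" "T \<in> sets lebesgue"
    and "\<And>t. t \<in> T \<Longrightarrow> t + a \<in> S"
  shows "esssup (lebesgue_on T) (\<lambda>t. f (t + a)) \<le> esssup (lebesgue_on S) f"
  by (intro esssup_I borel_measurable_translation_lebesgue_on[OF assms(1,4)]
      AE_lebesgue_on_translation[OF esssup_AE assms(2-4)])

lemma slice_hybrid_shift:
  "slice (hybrid_shift (t0, k0) E) k = {t. 0 \<le> t \<and> t + t0 \<in> slice E (k + k0)}"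
  by (simp add: slice_def)

lemma hybrid_input_shift:
  fixes u :: "real \<times> nat \<Rightarrow> 'a::euclidean_space"
  assumes u: "hybrid_input E u" and p0: "(t0, k0) \<in> E"
  shows "hybrid_input (hybrid_shift (t0, k0) E) (\<lambda>p. u (p + (t0, k0)))"
proof -
  let ?E' = "hybrid_shift (t0, k0) E"
  have E: "hybrid_time_domain E"
    and meas: "(\<lambda>t. u (t, k)) \<in> borel_measurable (lebesgue_on (slice E k))"
    and bdd: "compact S \<Longrightarrow> S \<subseteq> slice E k \<Longrightarrow> \<exists>B. AE t in lebesgue_on S. norm (u (t, k)) \<le> B" for k S
    using u by (auto simp: hybrid_input_def)
  have "(\<lambda>t. u ((t, k) + (t0, k0))) \<in> borel_measurable (lebesgue_on (slice ?E' k))" for k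
    using borel_measurable_translation_lebesgue_on[OF meas[of "k + k0"], of "slice ?E' k" t0]
    by (simp add: slice_hybrid_shift)
  moreover have "\<exists>B. AE t in lebesgue_on S. norm (u ((t, k) + (t0, k0))) \<le> B"
    if S: "compact S" "S \<subseteq> slice ?E' k" for S k
  proof -
    let ?S' = "(\<lambda>t. t + t0) ` S"
    have "compact ?S'"
      using S(1) by (intro compact_continuous_image continuous_intros)
    moreover have "?S' \<subseteq> slice E (k + k0)"
      using S(2) by (auto simp: slice_hybrid_shift)
    ultimately obtain B where "AE t in lebesgue_on ?S'. norm (u (t, k + k0)) \<le> B"
      using bdd by blast
    then have "AE t in lebesgue_on S. norm (u (t + t0, k + k0)) \<le> B"
      using \<open>compact ?S'\<close> S(1)
      by (intro AE_lebesgue_on_translation[where S = ?S' and P = "\<lambda>t. norm (u (t, k + k0)) \<le> B"])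
        (auto intro!: sets_completionI_sets borel_compact)
    then show ?thesis by auto
  qed
  ultimately show ?thesis
    unfolding hybrid_input_def using hybrid_time_domain_shift[OF E p0] by blast
qed

section \<open>Norms of hybrid signals\<close>

lemma borel_measurable_slice_flow:
  assumes "hybrid_input E u"
  shows "(\<lambda>t. ereal (norm (u (t, k))))
    \<in> borel_measurable (lebesgue_on (slice ((E - jump_times E) \<inter> hybrid_upto p) k))"
proof -
  have "(\<lambda>t. u (t, k)) \<in> borel_measurable (lebesgue_on (slice E k))"
    using assms by (simp add: hybrid_input_def)
  then have "(\<lambda>t. u (t, k))
      \<in> borel_measurable (lebesgue_on (slice ((E - jump_times E) \<inter> hybrid_upto p) k))"
    by (rule measurable_restrict_mono) (auto simp: slice_def)
  then show ?thesis by measurable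
qed

text \<open>Translation maps jump times to jump times and flow times to flow times, so the two
  suprema can be compared separately. Slice \<open>l\<close> after the restart is part of slice
  \<open>l + k0\<close> before it, which gives an inequality.\<close>

lemma hybrid_norm_upto_shift_le:
  assumes u: "hybrid_input E u" and p0: "(t0, k0) \<in> E"
  shows "hybrid_norm_upto (hybrid_shift (t0, k0) E) (\<lambda>p. u (p + (t0, k0))) p
    \<le> hybrid_norm_upto E u (p + (t0, k0))"
proof -
  let ?E' = "hybrid_shift (t0, k0) E"
  have E: "hybrid_time_domain E" "hybrid_time_domain ?E'"
    using u hybrid_time_domain_shift[OF _ p0] by (auto simp: hybrid_input_def)
  define S where "S l = slice ((E - jump_times E) \<inter> hybrid_upto (p + (t0, k0))) l" for l
  define T where "T l = slice ((?E' - jump_times ?E') \<inter> hybrid_upto p) l" for l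
  have "esssup (lebesgue_on (T l)) (\<lambda>t. ereal (norm (u ((t, l) + (t0, k0)))))
      \<le> (SUP l. esssup (lebesgue_on (S l)) (\<lambda>t. ereal (norm (u (t, l)))))" for l
  proof (rule SUP_upper2)
    have "esssup (lebesgue_on (T l)) (\<lambda>t. ereal (norm (u (t + t0, l + k0))))
        \<le> esssup (lebesgue_on (S (l + k0))) (\<lambda>t. ereal (norm (u (t, l + k0))))"
    proof (rule esssup_translation_le)
      show "S (l + k0) \<in> sets lebesgue" "T l \<in> sets lebesgue"
        unfolding S_def T_def by (intro slice_flow_sets_lebesgue E)+
      show "t + t0 \<in> S (l + k0)" if "t \<in> T l" for t
        using that by (auto simp: S_def T_def slice_def jump_times_def hybrid_upto_def)
    qed (use borel_measurable_slice_flow[OF u] in \<open>auto simp: S_def\<close>)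
    then show "esssup (lebesgue_on (T l)) (\<lambda>t. ereal (norm (u ((t, l) + (t0, k0)))))
        \<le> esssup (lebesgue_on (S (l + k0))) (\<lambda>t. ereal (norm (u (t, l + k0))))"
      by simp
  qed auto
  then have flow: "(SUP l. esssup (lebesgue_on (T l)) (\<lambda>t. ereal (norm (u ((t, l) + (t0, k0))))))
      \<le> (SUP l. esssup (lebesgue_on (S l)) (\<lambda>t. ereal (norm (u (t, l)))))"
    by (rule SUP_least)
  have "q + (t0, k0) \<in> jump_times E \<inter> hybrid_upto (p + (t0, k0))"
    if "q \<in> jump_times ?E' \<inter> hybrid_upto p" for q
    using that by (cases q) (auto simp: jump_times_def hybrid_upto_def)
  then have jump: "(SUP q\<in>jump_times ?E' \<inter> hybrid_upto p. ereal (norm (u (q + (t0, k0)))))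
      \<le> (SUP q\<in>jump_times E \<inter> hybrid_upto (p + (t0, k0)). ereal (norm (u q)))"
    by (intro SUP_mono) blast
  have "Sup {0, a, b} \<le> Sup {0, a', b'}" if "a \<le> a'" "b \<le> b'" for a b a' b' :: ereal
    using that by (intro Sup_mono) auto
  from this[OF flow jump] show ?thesis
    unfolding hybrid_norm_upto_def S_def T_def .
qed

lemma hybrid_norm_shift_le:
  assumes "hybrid_input E u" "(t0, k0) \<in> E"
  shows "hybrid_norm (hybrid_shift (t0, k0) E) (\<lambda>p. u (p + (t0, k0))) \<le> hybrid_norm E u"
  unfolding hybrid_norm_def
proof (rule SUP_least)
  fix p assume "p \<in> hybrid_shift (t0, k0) E"
  then have "p + (t0, k0) \<in> E"
    by (simp add: hybrid_shift_def)
  then show "hybrid_norm_upto (hybrid_shift (t0, k0) E) (\<lambda>p. u (p + (t0, k0))) p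
      \<le> (SUP p\<in>E. hybrid_norm_upto E u p)"
    by (rule SUP_upper2) (rule hybrid_norm_upto_shift_le[OF assms])
qed

text \<open>Rests on the entry 0 in \<open>hybrid_norm_upto\<close> and on \<open>(0, 0)\<close>
  being in the domain: a supremum over an empty set would be -\<infinity>.\<close>

lemma hybrid_norm_nonneg:
  assumes "hybrid_time_domain E"
  shows "0 \<le> hybrid_norm E u"
proof -
  have "0 \<le> hybrid_norm_upto E u (0, 0)"
    unfolding hybrid_norm_upto_def by (rule Sup_upper) simp
  then show ?thesis
    unfolding hybrid_norm_def using zero_mem_hybrid_time_domain[OF assms] by (rule SUP_upper2[rotated])
qed

lemma hybrid_norm_le:
  assumes u: "hybrid_input E u" and c: "0 \<le> c" and le: "\<And>p. p \<in> E \<Longrightarrow> norm (u p) \<le> c"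
  shows "hybrid_norm E u \<le> ereal c"
proof -
  have E: "hybrid_time_domain E"
    using u by (simp add: hybrid_input_def)
  have "esssup (lebesgue_on (slice ((E - jump_times E) \<inter> hybrid_upto p) l)) (\<lambda>s. ereal (norm (u (s, l))))
      \<le> ereal c" for p l
  proof (intro esssup_I borel_measurable_slice_flow u AE_I2)
    fix t assume "t \<in> space (lebesgue_on (slice ((E - jump_times E) \<inter> hybrid_upto p) l))"
    then have "(t, l) \<in> E"
      by (simp add: slice_def)
    then show "ereal (norm (u (t, l))) \<le> ereal c"
      using le by simp
  qed
  then have flow: "(SUP l. esssup (lebesgue_on (slice ((E - jump_times E) \<inter> hybrid_upto p) l))
      (\<lambda>s. ereal (norm (u (s, l))))) \<le> ereal c" for p
    by (rule SUP_least)
  have jump: "(SUP q\<in>jump_times E \<inter> hybrid_upto p. ereal (norm (u q))) \<le> ereal c" for p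
    using le by (intro SUP_least) (auto simp: jump_times_def)
  have "Sup {0, a, b} \<le> ereal c" if "a \<le> ereal c" "b \<le> ereal c" for a b
    using that c by (intro Sup_least) auto
  from this[OF flow jump] have "hybrid_norm_upto E u p \<le> ereal c" for p
    unfolding hybrid_norm_upto_def .
  then show ?thesis
    unfolding hybrid_norm_def by (intro SUP_least)
qed

section \<open>Bounded arcs as inputs of other subsystems\<close>

lemma abs_continuous_on_imp_continuous_on:
  assumes "abs_continuous_on {a..b} h"
  shows "continuous_on {a..b} h"
  unfolding continuous_on_iff
proof (intro ballI allI impI)
  fix s and e :: real assume s: "s \<in> {a..b}" and "0 < e"
  with assms obtain d where "d > 0" and
    H: "\<forall>P. finite P \<and> (\<forall>(s, t)\<in>P. s \<le> t \<and> {s..t} \<subseteq> {a..b}) \<and>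
        disjoint_family_on (\<lambda>(s, t). {s<..<t}) P \<and> (\<Sum>(s, t)\<in>P. t - s) < d \<longrightarrow>
        (\<Sum>(s, t)\<in>P. norm (h t - h s)) < e"
    unfolding abs_continuous_on_def by blast
  have "dist (h t) (h s) < e" if "t \<in> {a..b}" "dist t s < d" for t
    using H[THEN spec, of "{(min s t, max s t)}"] s that
    by (cases "s \<le> t") (auto simp: disjoint_family_on_def dist_norm norm_minus_commute)
  with \<open>d > 0\<close> show "\<exists>d>0. \<forall>t\<in>{a..b}. dist t s < d \<longrightarrow> dist (h t) (h s) < e"
    by blast
qed

text \<open>Absolute continuity is known on compact intervals only, while a slice may be half-open
  or unbounded. Continuity is local, so around each point a compact interval is chosen that is a
  neighbourhood relative to the slice.\<close>

lemma hybrid_arc_continuous_on_slice: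
  assumes "hybrid_arc E x"
  shows "continuous_on (slice E k) (\<lambda>t. x (t, k))"
  unfolding continuous_on_eq_continuous_within
proof
  have E: "hybrid_time_domain E"
    using assms by (simp add: hybrid_arc_def)
  fix s assume s: "s \<in> slice E k"
  obtain a where a: "a \<in> slice E k" "a < s \<or> (a = s \<and> slice E k \<inter> {..<s} = {})"
    using s by (cases "slice E k \<inter> {..<s} = {}") auto
  obtain b where b: "b \<in> slice E k" "s < b \<or> (b = s \<and> slice E k \<inter> {s<..} = {})"
    using s by (cases "slice E k \<inter> {s<..} = {}") auto
  have ab: "{a..b} \<subseteq> slice E k"
    using hybrid_time_interval[OF E, of a k b] a(1) b(1) by (auto simp: slice_def)
  then have "continuous_on {a..b} (\<lambda>t. x (t, k))"
    using assms by (intro abs_continuous_on_imp_continuous_on) (simp add: hybrid_arc_def)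
  moreover have "s \<in> {a..b}"
    using a(2) b(2) by auto
  ultimately have "continuous (at s within {a..b}) (\<lambda>t. x (t, k))"
    by (simp add: continuous_on_eq_continuous_within)
  moreover have "at s within {a..b} = at s within slice E k"
  proof (rule at_within_nhd)
    \<comment> \<open>If \<open>a = s\<close> or \<open>b = s\<close>, the slice has no points on
      that side of \<open>s\<close>, so \<open>U\<close> may be unrestricted there.\<close>
    define U where
      "U = (if a < s then {a<..} else UNIV) \<inter> (if s < b then {..<b} else UNIV)"
    show "open U" "s \<in> U"
      by (auto simp: U_def)
    show "{a..b} \<inter> U - {s} = slice E k \<inter> U - {s}"
      using ab a(2) b(2) by (fastforce simp: U_def split: if_splits)
  qed
  ultimately show "continuous (at s within slice E k) (\<lambda>t. x (t, k))"
    by simp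
qed

text \<open>In the interconnection the state of one subsystem is an input of the others. Continuity
  on slices gives measurability, and the global bound gives local essential boundedness.\<close>

lemma bounded_hybrid_arc_imp_input:
  assumes x: "hybrid_arc E x" and bdd: "bounded (x ` E)"
  shows "hybrid_input E x"
proof -
  have E: "hybrid_time_domain E"
    using x by (simp add: hybrid_arc_def)
  obtain B where B: "\<And>p. p \<in> E \<Longrightarrow> norm (x p) \<le> B"
    using bdd by (auto simp: bounded_iff)
  have "(\<lambda>t. x (t, k)) \<in> borel_measurable (lebesgue_on (slice E k))" for k
    by (intro continuous_imp_measurable_on_sets_lebesgue hybrid_arc_continuous_on_slice x
        slice_sets_lebesgue E)
  moreover have "\<exists>B. AE t in lebesgue_on S. norm (x (t, k)) \<le> B" if "S \<subseteq> slice E k" for S k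
    using that B by (intro exI[of _ B] AE_I2) (auto simp: slice_def)
  ultimately show ?thesis
    using E by (simp add: hybrid_input_def)
qed

text \<open>Everything except the initial condition is inherited by translation. Membership in the
  flow set is known only for almost all times, so the condition at the new origin has to be supplied
  by \<open>start\<close>.\<close>

lemma overall_solution_shift:
  assumes sol: "overall_solution H E x u" and p0: "(t0, k0) \<in> E"
    and start: "(x (t0, k0), u (t0, k0)) \<in> overall_flow_set H \<union> overall_jump_set H"
  shows "overall_solution H (hybrid_shift (t0, k0) E)
    (\<lambda>p. x (p + (t0, k0))) (\<lambda>p. u (p + (t0, k0)))"
proof -
  let ?E' = "hybrid_shift (t0, k0) E"
  have "AE t in lebesgue. (t, k) \<in> ?E' \<longrightarrow>
        (x ((t, k) + (t0, k0)), u ((t, k) + (t0, k0))) \<in> overall_flow_set H \<and>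
        ((\<lambda>s. x ((s, k) + (t0, k0))) has_vector_derivative
          overall_flow_map H (x ((t, k) + (t0, k0)), u ((t, k) + (t0, k0)))) (at t within slice ?E' k)"
    (is "AE t in _. ?P t") for k
  proof -
    have "AE t in lebesgue. (t, k + k0) \<in> E \<longrightarrow>
        (x (t, k + k0), u (t, k + k0)) \<in> overall_flow_set H \<and>
        ((\<lambda>s. x (s, k + k0)) has_vector_derivative
          overall_flow_map H (x (t, k + k0), u (t, k + k0))) (at t within slice E (k + k0))"
      using sol by (simp add: overall_solution_def)
    then have "AE t in lebesgue. (t + t0, k + k0) \<in> E \<longrightarrow>
        (x (t + t0, k + k0), u (t + t0, k + k0)) \<in> overall_flow_set H \<and>
        ((\<lambda>s. x (s, k + k0)) has_vector_derivative
          overall_flow_map H (x (t + t0, k + k0), u (t + t0, k + k0)))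
          (at (t + t0) within slice E (k + k0))"
      by (rule AE_lebesgue_translation)
    then show ?thesis
    proof (rule eventually_mono, intro impI)
      fix t
      assume *: "(t + t0, k + k0) \<in> E \<longrightarrow>
        (x (t + t0, k + k0), u (t + t0, k + k0)) \<in> overall_flow_set H \<and>
        ((\<lambda>s. x (s, k + k0)) has_vector_derivative
          overall_flow_map H (x (t + t0, k + k0), u (t + t0, k + k0)))
          (at (t + t0) within slice E (k + k0))"
      assume "(t, k) \<in> ?E'"
      with * have F: "(x (t + t0, k + k0), u (t + t0, k + k0)) \<in> overall_flow_set H"
        and D: "((\<lambda>s. x (s, k + k0)) has_vector_derivative
          overall_flow_map H (x (t + t0, k + k0), u (t + t0, k + k0)))
          (at (t + t0) within slice E (k + k0))" by auto
      \<comment> \<open>The derivative is first restricted to the translated slice; the chain rule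
        with inner derivative 1 then moves it to \<open>t\<close>.\<close>
      have "((\<lambda>s. x (s, k + k0)) has_vector_derivative
          overall_flow_map H (x (t + t0, k + k0), u (t + t0, k + k0)))
          (at (t + t0) within (\<lambda>s. s + t0) ` slice ?E' k)"
        by (rule has_vector_derivative_within_subset[OF D]) (auto simp: slice_hybrid_shift)
      then have "((\<lambda>s. x (s, k + k0)) \<circ> (\<lambda>s. s + t0) has_vector_derivative
          1 *\<^sub>R overall_flow_map H (x (t + t0, k + k0), u (t + t0, k + k0))) (at t within slice ?E' k)"
        by (intro vector_diff_chain_within) (auto intro!: derivative_eq_intros)
      with F show "(x ((t, k) + (t0, k0)), u ((t, k) + (t0, k0))) \<in> overall_flow_set H \<and>
        ((\<lambda>s. x ((s, k) + (t0, k0))) has_vector_derivative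
          overall_flow_map H (x ((t, k) + (t0, k0)), u ((t, k) + (t0, k0)))) (at t within slice ?E' k)"
        by (simp add: o_def)
    qed
  qed
  moreover have "hybrid_arc ?E' (\<lambda>p. x (p + (t0, k0)))" "hybrid_input ?E' (\<lambda>p. u (p + (t0, k0)))"
    using sol p0 hybrid_arc_shift hybrid_input_shift unfolding overall_solution_def by blast+
  moreover have "\<forall>p\<in>?E'. x (p + (t0, k0)) \<in> overall_states H \<and> u (p + (t0, k0)) \<in> inputs H"
    using sol by (auto simp: overall_solution_def hybrid_shift_def)
  moreover have "\<forall>t k. (t, k) \<in> ?E' \<and> (t, Suc k) \<in> ?E' \<longrightarrow>
        (x ((t, k) + (t0, k0)), u ((t, k) + (t0, k0))) \<in> overall_jump_set H \<and>
        x ((t, Suc k) + (t0, k0)) = overall_jump_map H (x ((t, k) + (t0, k0)), u ((t, k) + (t0, k0)))"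
    using sol by (auto simp: overall_solution_def)
  ultimately show ?thesis
    using start unfolding overall_solution_def by simp
qed

text \<open>Take two late points, one after the other. If they lie in different slices, the jump
  leaving the earlier slice starts in the jump set. If they share a slice, they span an interval of
  positive length, and almost every time in it lies in the flow set.\<close>

lemma hybrid_restart_exists:
  assumes sol: "overall_solution H E x u" and complete: "complete_domain E"
  shows "\<exists>t k. (t, k) \<in> E \<and> T \<le> t + real k \<and>
    (x (t, k), u (t, k)) \<in> overall_flow_set H \<union> overall_jump_set H"
proof -
  have E: "hybrid_time_domain E"
    using sol by (simp add: overall_solution_def hybrid_arc_def)
  obtain s l where sl: "(s, l) \<in> E" "T < s + real l"
    using complete_domainD[OF complete] by blast
  obtain s' l' where sl': "(s', l') \<in> E" "s + real l < s' + real l'"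
    using complete_domainD[OF complete] by blast
  have le: "s \<le> s'" "l \<le> l'"
    using hybrid_time_le[OF E sl(1) sl'] by auto
  show ?thesis
  proof (cases "l = l'")
    case False
    with le obtain a where a: "(a, l) \<in> E" "(a, Suc l) \<in> E"
      using hybrid_jump_exists[OF E sl'(1), of l] by auto
    then have "s \<le> a"
      using hybrid_time_mono[OF E sl(1) a(2)] by simp
    moreover have "(x (a, l), u (a, l)) \<in> overall_jump_set H"
      using sol a by (simp add: overall_solution_def)
    ultimately show ?thesis
      using a sl by (intro exI[of _ a] exI[of _ l]) auto
  next
    case True
    have mem: "(t, l) \<in> E" if "t \<in> {s..s'}" for t
      using hybrid_time_interval[OF E sl(1), of s' t] sl'(1) that True by auto
    have "AE t in lebesgue. (t, l) \<in> E \<longrightarrow> (x (t, l), u (t, l)) \<in> overall_flow_set H"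
      using sol by (auto simp: overall_solution_def elim!: eventually_mono dest!: spec[of _ l])
    then have "negligible {t. \<not> ((t, l) \<in> E \<longrightarrow> (x (t, l), u (t, l)) \<in> overall_flow_set H)}"
      by (simp add: eventually_ae_filter_negligible) (meson negligible_subset)
    moreover have "\<not> negligible {s..s'}"
      using sl'(2) True negligible_interval(1)[of s s'] by simp
    ultimately obtain t where "t \<in> {s..s'}"
      "(t, l) \<in> E \<longrightarrow> (x (t, l), u (t, l)) \<in> overall_flow_set H"
      using negligible_subset by blast
    with mem sl(2) show ?thesis
      by (intro exI[of _ t] exI[of _ l]) auto
  qed
qed

section \<open>Asymptotic gains\<close>

lemma hybrid_arc_component:
  assumes "hybrid_arc E x"
  shows "hybrid_arc E (\<lambda>p. x p $ i)"
  unfolding hybrid_arc_def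
proof (intro conjI allI impI)
  show "hybrid_time_domain E"
    using assms by (simp add: hybrid_arc_def)
  fix k a b assume "{a..b} \<subseteq> slice E k"
  with assms have ac: "abs_continuous_on {a..b} (\<lambda>t. x (t, k))"
    by (simp add: hybrid_arc_def)
  show "abs_continuous_on {a..b} (\<lambda>t. x (t, k) $ i)"
    unfolding abs_continuous_on_def
  proof (intro allI impI)
    fix e :: real assume "e > 0"
    with ac obtain d where "d > 0" and
      H: "\<forall>P. finite P \<and> (\<forall>(s, t)\<in>P. s \<le> t \<and> {s..t} \<subseteq> {a..b}) \<and>
        disjoint_family_on (\<lambda>(s, t). {s<..<t}) P \<and> (\<Sum>(s, t)\<in>P. t - s) < d \<longrightarrow>
        (\<Sum>(s, t)\<in>P. norm (x (t, k) - x (s, k))) < e"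
      unfolding abs_continuous_on_def by blast
    have "(\<Sum>(s, t)\<in>P. norm (x (t, k) $ i - x (s, k) $ i))
        \<le> (\<Sum>(s, t)\<in>P. norm (x (t, k) - x (s, k)))" for P
      by (rule sum_mono)
        (auto simp flip: vector_minus_component intro: Finite_Cartesian_Product.norm_nth_le)
    then show "\<exists>d>0. \<forall>P. finite P \<and> (\<forall>(s, t)\<in>P. s \<le> t \<and> {s..t} \<subseteq> {a..b}) \<and>
        disjoint_family_on (\<lambda>(s, t). {s<..<t}) P \<and> (\<Sum>(s, t)\<in>P. t - s) < d \<longrightarrow>
        (\<Sum>(s, t)\<in>P. norm (x (t, k) $ i - x (s, k) $ i)) < e"
      using H \<open>d > 0\<close> by (blast intro: le_less_trans)
  qed
qed

text \<open>Since the jump sets coincide, at each jump every subsystem jumps by its own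
  \<open>jump_map\<close> and none keeps its state. Boundedness makes the state components
  admissible inputs.\<close>

lemma overall_imp_subsystem_solution:
  assumes sol: "overall_solution H E x u" and bdd: "bounded (x ` E)"
    and jump: "\<forall>i. jump_set H i = overall_jump_set H"
  shows "subsystem_solution H i E x u"
proof -
  have arc: "hybrid_arc E x"
    using sol by (simp add: overall_solution_def)
  have "bounded ((\<lambda>p. x p $ j) ` E)" for j
    using bounded_component_cart[OF bdd, of j] by (simp add: image_image)
  then have "hybrid_input E (\<lambda>p. x p $ j)" for j
    by (intro bounded_hybrid_arc_imp_input hybrid_arc_component arc)
  moreover have "AE t in lebesgue. (t, k) \<in> E \<longrightarrow>
        (x (t, k), u (t, k)) \<in> flow_set H i \<and>
        ((\<lambda>s. x (s, k) $ i) has_vector_derivative flow_map H i (x (t, k), u (t, k)))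
          (at t within slice E k)" for k
  proof -
    have "AE t in lebesgue. (t, k) \<in> E \<longrightarrow>
        (x (t, k), u (t, k)) \<in> overall_flow_set H \<and>
        ((\<lambda>s. x (s, k)) has_vector_derivative overall_flow_map H (x (t, k), u (t, k)))
          (at t within slice E k)"
      using sol by (simp add: overall_solution_def)
    then show ?thesis
    proof (rule eventually_mono, intro impI)
      fix t
      assume *: "(t, k) \<in> E \<longrightarrow>
        (x (t, k), u (t, k)) \<in> overall_flow_set H \<and>
        ((\<lambda>s. x (s, k)) has_vector_derivative overall_flow_map H (x (t, k), u (t, k)))
          (at t within slice E k)" and "(t, k) \<in> E"
      then have "((\<lambda>s. x (s, k) $ i) has_vector_derivative overall_flow_map H (x (t, k), u (t, k)) $ i)
          (at t within slice E k)"
        by (intro bounded_linear.has_vector_derivative[OF bounded_linear_vec_nth]) blast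
      with * \<open>(t, k) \<in> E\<close> show "(x (t, k), u (t, k)) \<in> flow_set H i \<and>
        ((\<lambda>s. x (s, k) $ i) has_vector_derivative flow_map H i (x (t, k), u (t, k)))
          (at t within slice E k)"
        by (simp add: overall_flow_set_def overall_flow_map_def)
    qed
  qed
  moreover have "(x (0, 0), u (0, 0)) \<in> flow_set H i \<union> jump_set H i"
    using sol jump unfolding overall_solution_def by (auto simp: overall_flow_set_def)
  moreover have "\<forall>t k. (t, k) \<in> E \<and> (t, Suc k) \<in> E \<longrightarrow>
        (x (t, k), u (t, k)) \<in> jump_set H i \<and>
        x (t, Suc k) $ i = jump_map H i (x (t, k), u (t, k))"
    using sol jump by (simp add: overall_solution_def overall_jump_map_def)
  ultimately show ?thesis
    using sol hybrid_arc_component[OF arc] unfolding subsystem_solution_def overall_solution_def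
    by blast
qed

section \<open>Limits along hybrid time\<close>

lemma eventually_hybrid_at_top:
  "eventually P (hybrid_at_top E) \<longleftrightarrow> (\<exists>T. \<forall>t k. (t, k) \<in> E \<longrightarrow> T \<le> t + real k \<longrightarrow> P (t, k))"
proof
  assume "eventually P (hybrid_at_top E)"
  then obtain Q where Q: "eventually Q at_top" "\<And>t k. Q (t + real k) \<Longrightarrow> (t, k) \<in> E \<Longrightarrow> P (t, k)"
    by (auto simp: hybrid_at_top_def eventually_inf_principal eventually_filtercomap)
  from Q(1) obtain T where "\<And>r. T \<le> r \<Longrightarrow> Q r"
    by (auto simp: eventually_at_top_linorder)
  with Q(2) show "\<exists>T. \<forall>t k. (t, k) \<in> E \<longrightarrow> T \<le> t + real k \<longrightarrow> P (t, k)"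
    by blast
next
  assume "\<exists>T. \<forall>t k. (t, k) \<in> E \<longrightarrow> T \<le> t + real k \<longrightarrow> P (t, k)"
  then obtain T where "\<And>t k. (t, k) \<in> E \<Longrightarrow> T \<le> t + real k \<Longrightarrow> P (t, k)"
    by blast
  then show "eventually P (hybrid_at_top E)"
    unfolding hybrid_at_top_def eventually_inf_principal eventually_filtercomap
    by (intro exI[of _ "\<lambda>r. T \<le> r"]) (auto simp: eventually_ge_at_top)
qed

text \<open>Along the trivial filter every \<open>Limsup\<close> would be -\<infinity>; excluding it
  makes the limits superior of norms nonnegative.\<close>

lemma hybrid_at_top_neq_bot:
  assumes "complete_domain E"
  shows "hybrid_at_top E \<noteq> bot"
proof
  assume "hybrid_at_top E = bot"
  then have "eventually (\<lambda>_. False) (hybrid_at_top E)"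
    by simp
  then obtain T where "\<And>t k. (t, k) \<in> E \<Longrightarrow> \<not> T \<le> t + real k"
    unfolding eventually_hybrid_at_top by blast
  moreover obtain t k where "(t, k) \<in> E" "T < t + real k"
    using complete_domainD[OF assms] by blast
  ultimately show False
    by fastforce
qed

lemma eventually_hybrid_at_top_shift:
  assumes E: "hybrid_time_domain E" and p0: "(t0, k0) \<in> E"
    and ev: "eventually (\<lambda>p. P (p + (t0, k0))) (hybrid_at_top (hybrid_shift (t0, k0) E))"
  shows "eventually P (hybrid_at_top E)"
proof -
  obtain T where T: "\<And>t k. (t, k) \<in> hybrid_shift (t0, k0) E \<Longrightarrow> T \<le> t + real k \<Longrightarrow> P ((t, k) + (t0, k0))"
    using ev unfolding eventually_hybrid_at_top by blast
  \<comment> \<open>The 1 in the maximum yields the strict inequality that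
    \<open>hybrid_time_le\<close> requires.\<close>
  have "P (t, k)" if tk: "(t, k) \<in> E" "max T 1 + (t0 + real k0) \<le> t + real k" for t k
  proof -
    have "t0 + real k0 < t + real k"
      using tk(2) by linarith
    then have le: "t0 \<le> t \<and> k0 \<le> k"
      by (rule hybrid_time_le[OF E p0 tk(1)])
    with T[of "t - t0" "k - k0"] tk show ?thesis
      by (simp add: of_nat_diff)
  qed
  then show ?thesis
    unfolding eventually_hybrid_at_top by blast
qed

section \<open>Gains at extended arguments\<close>

lemma gain_ext_le:
  assumes g: "monotone_gain g" and r: "0 \<le> r" "r \<le> ereal c"
  shows "gain_ext g r \<le> ereal (g c)"
proof -
  obtain r' where "r = ereal r'"
    using r by (cases r) auto
  with r show ?thesis
    using monotone_gain_mono[OF g, of r' c] by (simp add: gain_ext_def)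
qed

lemma gain_ext_infinity:
  assumes "class_Kinf g"
  shows "gain_ext g \<infinity> = \<infinity>"
proof -
  have "(SUP s\<in>{0..}. ereal (g s)) = \<infinity>"
  proof (rule SUP_PInfty)
    fix n :: nat
    obtain s where "s \<ge> 0" "g s > real n"
      using assms unfolding class_Kinf_def by blast
    then show "\<exists>s\<in>{0..}. ereal (real n) \<le> ereal (g s)"
      by (intro bexI[of _ s]) auto
  qed
  then show ?thesis by (simp add: gain_ext_def)
qed

text \<open>Restarting the solution at a late time turns the suprema of the internal inputs in the
  asymptotic gain property into their limits superior.\<close>

lemma overall_solution_asymptotic_gain:
  assumes card: "CARD('n::finite) \<ge> 2"
    and AG: "subsystem_AG (H :: ('n, 'm::finite, 'p::finite) hybrid_network) i g gu"
    and jump: "\<forall>i. jump_set H i = overall_jump_set H"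
    and sol: "overall_solution H E x u" and complete: "complete_domain E" and bdd: "bounded (x ` E)"
    and r: "hybrid_norm E u = ereal r"
    and lim: "\<And>j. Limsup (hybrid_at_top E) (\<lambda>p. ereal (norm (x p $ j))) = ereal (s j)"
  shows "s i \<le> gu r \<or> (\<exists>j. j \<noteq> i \<and> s i \<le> g j (s j))"
proof -
  have E: "hybrid_time_domain E" and u: "hybrid_input E u"
    using sol by (auto simp: overall_solution_def hybrid_arc_def)
  have gj: "monotone_gain (g j)" if "j \<noteq> i" for j
    using AG that by (intro gain_imp_monotone_gain) (simp add: subsystem_AG_def)
  have gu: "monotone_gain gu"
    using AG by (intro gain_imp_monotone_gain) (simp add: subsystem_AG_def)
  have s0: "0 \<le> s j" for j
  proof -
    have "0 \<le> Limsup (hybrid_at_top E) (\<lambda>p. ereal (norm (x p $ j)))"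
      by (intro le_Limsup hybrid_at_top_neq_bot complete always_eventually allI) simp
    then show ?thesis by (simp add: lim)
  qed
  have others: "finite {j. j \<noteq> i}" "{j. j \<noteq> i} \<noteq> {}"
  proof -
    have "UNIV \<noteq> {i}"
    proof
      assume "UNIV = {i}"
      then have "CARD('n) = card {i}" by (simp only:)
      with card show False by simp
    qed
    then show "{j. j \<noteq> i} \<noteq> {}" by auto
  qed simp
  \<comment> \<open>The slack \<open>e\<close> is unavoidable at this stage: late in time the
    components are below \<open>s j + e\<close>, though possibly never below \<open>s j\<close>. The
    restart is placed after that time.\<close>
  have step: "s i \<le> gu r \<or> (\<exists>j. j \<noteq> i \<and> s i \<le> g j (s j + e))" if e: "e > 0" for e
  proof -
    have "eventually (\<lambda>p. norm (x p $ j) < s j + e) (hybrid_at_top E)" for j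
      using Limsup_lessD[of "hybrid_at_top E" "\<lambda>p. ereal (norm (x p $ j))" "ereal (s j + e)"] e
      by (simp add: lim)
    then have "eventually (\<lambda>p. \<forall>j. norm (x p $ j) < s j + e) (hybrid_at_top E)"
      by (rule eventually_all_finite)
    then obtain T where T: "\<And>t k j. (t, k) \<in> E \<Longrightarrow> T \<le> t + real k \<Longrightarrow> norm (x (t, k) $ j) < s j + e"
      unfolding eventually_hybrid_at_top by blast
    obtain t0 k0 where p0: "(t0, k0) \<in> E" and T0: "T \<le> t0 + real k0"
      and start: "(x (t0, k0), u (t0, k0)) \<in> overall_flow_set H \<union> overall_jump_set H"
      using hybrid_restart_exists[OF sol complete] by blast
    define E' where "E' = hybrid_shift (t0, k0) E"
    define x' where "x' = (\<lambda>p. x (p + (t0, k0)))"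
    define u' where "u' = (\<lambda>p. u (p + (t0, k0)))"
    have sol': "overall_solution H E' x' u'"
      unfolding E'_def x'_def u'_def by (rule overall_solution_shift[OF sol p0 start])
    have "x' ` E' \<subseteq> x ` E"
      by (auto simp: x'_def E'_def hybrid_shift_def)
    with bdd have bdd': "bounded (x' ` E')"
      by (rule bounded_subset)
    have sub: "subsystem_solution H j E' x' u'" for j
      by (rule overall_imp_subsystem_solution[OF sol' bdd' jump])
    have complete': "complete_domain E'"
      unfolding E'_def by (rule complete_domain_shift[OF E complete p0])
    have max: "maximal_pair (subsystem_solution H i) E' x' u'"
      by (rule complete_imp_maximal_pair[where sol = "subsystem_solution H i", OF _ sub complete'])
        (auto simp: subsystem_solution_def hybrid_arc_def)
    have E'_dom: "hybrid_time_domain E'"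
      unfolding E'_def by (rule hybrid_time_domain_shift[OF E p0])
    let ?g = "\<lambda>j. gain_ext (g j) (hybrid_norm E' (\<lambda>p. x' p $ j))"
    \<comment> \<open>A bound that holds eventually along the restarted solution holds eventually
      along the original one.\<close>
    have "ereal (s i) \<le> Limsup (hybrid_at_top E') (\<lambda>p. ereal (norm (x' p $ i)))"
      unfolding lim[symmetric] Limsup_le_iff
    proof (intro allI impI)
      fix y assume "y > Limsup (hybrid_at_top E') (\<lambda>p. ereal (norm (x' p $ i)))"
      then have "eventually (\<lambda>p. ereal (norm (x' p $ i)) < y) (hybrid_at_top E')"
        by (rule Limsup_lessD)
      then show "eventually (\<lambda>p. ereal (norm (x p $ i)) < y) (hybrid_at_top E)"
        unfolding E'_def x'_def
        by (rule eventually_hybrid_at_top_shift[where P = "\<lambda>p. ereal (norm (x p $ i)) < y", OF E p0])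
    qed
    also have "\<dots> \<le> max (Max (?g ` {j. j \<noteq> i})) (gain_ext gu (hybrid_norm E' u'))"
      using AG max complete' unfolding subsystem_AG_def by blast
    finally have "ereal (s i) \<le> Max (?g ` {j. j \<noteq> i}) \<or> ereal (s i) \<le> gain_ext gu (hybrid_norm E' u')"
      by (simp add: le_max_iff_disj)
    then show ?thesis
    proof
      assume "ereal (s i) \<le> Max (?g ` {j. j \<noteq> i})"
      then obtain j where j: "j \<noteq> i" "ereal (s i) \<le> ?g j"
        using others by (subst (asm) Max_ge_iff) auto
      \<comment> \<open>After the restart the bound holds at every hybrid time, so it controls the
        norm of the whole signal and not merely its limit superior.\<close>
      have "hybrid_norm E' (\<lambda>p. x' p $ j) \<le> ereal (s j + e)"
      proof (rule hybrid_norm_le)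
        show "hybrid_input E' (\<lambda>p. x' p $ j)"
          using bounded_component_cart[OF bdd', of j] sol'
          by (intro bounded_hybrid_arc_imp_input hybrid_arc_component)
            (simp_all add: overall_solution_def image_image)
        show "0 \<le> s j + e"
          using s0[of j] e by simp
        fix p assume "p \<in> E'"
        then show "norm (x' p $ j) \<le> s j + e"
          using T[of "fst p + t0" "snd p + k0" j] T0 hybrid_time_nonneg[OF E'_dom]
          by (cases p) (auto simp: E'_def x'_def)
      qed
      then have "?g j \<le> ereal (g j (s j + e))"
        using hybrid_norm_nonneg[OF E'_dom] by (intro gain_ext_le gj j) auto
      with j have "ereal (s i) \<le> ereal (g j (s j + e))"
        by (meson order_trans)
      with j(1) show ?thesis by auto
    next
      assume "ereal (s i) \<le> gain_ext gu (hybrid_norm E' u')"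
      also have "\<dots> \<le> ereal (gu r)"
        using hybrid_norm_shift_le[OF u p0]
        by (intro gain_ext_le gu hybrid_norm_nonneg E'_dom) (simp add: E'_def u'_def r)
      finally show ?thesis by simp
    qed
  qed
  \<comment> \<open>The slack tends to 0. If all the inequalities failed at \<open>s j\<close>,
    right-continuity of the finitely many \<open>g j\<close> would make them fail for one common
    small \<open>e > 0\<close>, contradicting \<open>step\<close>. One-sided limits also cover
    \<open>s j = 0\<close>.\<close>
  show ?thesis
  proof (rule ccontr)
    assume "\<not> ?thesis"
    then have "\<not> s i \<le> gu r" and less: "\<And>j. j \<noteq> i \<Longrightarrow> g j (s j) < s i"
      by (auto simp: not_le)
    have "eventually (\<lambda>e. g j (s j + e) < s i) (at_right 0)" if "j \<noteq> i" for j
    proof -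
      have "(g \<longlongrightarrow> g (s j)) (at (s j) within {0..})" if "continuous_on {0..} g" for g :: "real \<Rightarrow> real"
        using that s0[of j] by (auto simp: continuous_on_def)
      then have "(g j \<longlongrightarrow> g j (s j)) (at (s j) within {0..})"
        using gj[OF \<open>j \<noteq> i\<close>] by (simp add: monotone_gain_def)
      then have "(g j \<longlongrightarrow> g j (s j)) (at_right (s j))"
        by (rule tendsto_within_subset) (use s0[of j] in auto)
      then have "eventually (\<lambda>t. g j t < s i) (at_right (s j))"
        using less[OF \<open>j \<noteq> i\<close>] by (rule order_tendstoD)
      then show ?thesis
        by (simp add: eventually_at_right_to_0[of _ "s j"] add.commute)
    qed
    then have "eventually (\<lambda>e. \<forall>j\<in>{j. j \<noteq> i}. g j (s j + e) < s i) (at_right 0)"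
      using others(1) by (intro eventually_ball_finite) auto
    then have "eventually (\<lambda>e. e > 0 \<and> (\<forall>j\<in>{j. j \<noteq> i}. g j (s j + e) < s i)) (at_right (0::real))"
      using eventually_at_right_less by (rule eventually_conj[rotated])
    then obtain e where "e > 0" "\<forall>j. j \<noteq> i \<longrightarrow> g j (s j + e) < s i"
      using eventually_happens trivial_limit_at_right_real by blast
    with step[of e] \<open>\<not> s i \<le> gu r\<close> show False
      by force
  qed
qed

section \<open>The gain of the overall system\<close>

theorem theorem3p2:
  fixes H :: "('n::finite, 'm::finite, 'p::finite) hybrid_network"
    and \<gamma>t :: "'n \<Rightarrow> 'n \<Rightarrow> real \<Rightarrow> real"
    and \<gamma>u :: "'n \<Rightarrow> real \<Rightarrow> real"
  assumes "CARD('n) \<ge> 2"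
    and "interconnection H"
    and "\<forall>i. jump_set H i = overall_jump_set H"
    and "\<forall>i. subsystem_AG H i (\<gamma>t i) (\<gamma>u i)"
    and "\<exists>E x u. overall_solution H E x u"
    and "\<forall>E x u. maximal_pair (overall_solution H) E x u \<longrightarrow> bounded (x ` E)"
    and "\<exists>E x u. overall_solution H E x u \<and> complete_domain E"
    and "\<forall>s :: real^'n. 0 \<le> s \<and> s \<noteq> 0 \<longrightarrow> \<not> s \<le> Gamma_max (gain_matrix \<gamma>t) s"
  shows "overall_AG H \<and>
    (\<exists>\<gamma>. gain \<gamma> \<and>
      (\<forall>E x u. overall_solution H E x u \<and> complete_domain E \<longrightarrow>
         Limsup (hybrid_at_top E) (\<lambda>p. ereal (norm (x p))) \<le> gain_ext \<gamma> (hybrid_norm E u)))"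
proof -
  define B where "B i r = gain_iterate \<gamma>t \<gamma>u CARD('n) i r" for i r
  \<comment> \<open>The sum over all components dominates the Euclidean norm of the concatenated
    state; the identity makes the gain of class K-infinity.\<close>
  define \<gamma> where "\<gamma> r = r + (\<Sum>i\<in>UNIV. B i r)" for r
  have \<gamma>t: "monotone_gain (\<gamma>t i j)" if "j \<noteq> i" for i j
    using assms(4) that by (intro gain_imp_monotone_gain) (simp add: subsystem_AG_def)
  have \<gamma>u: "monotone_gain (\<gamma>u i)" for i
    using assms(4) by (intro gain_imp_monotone_gain) (simp add: subsystem_AG_def)
  have "monotone_gain (gain_iterate \<gamma>t \<gamma>u CARD('n) i)" for i
    by (rule monotone_gain_iterate[where g = \<gamma>t and v = \<gamma>u, OF \<gamma>t \<gamma>u])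
  then have Kinf: "class_Kinf \<gamma>"
    unfolding \<gamma>_def B_def by (intro class_Kinf_id_add monotone_gain_sum)
  have bound: "Limsup (hybrid_at_top E) (\<lambda>p. ereal (norm (x p))) \<le> gain_ext \<gamma> (hybrid_norm E u)"
    if sol: "overall_solution H E x u" and complete: "complete_domain E" for E x u
  proof (cases "hybrid_norm E u")
    case PInf
    then show ?thesis
      by (simp add: gain_ext_infinity[OF Kinf])
  next
    case MInf
    then show ?thesis
      using hybrid_norm_nonneg[of E u] sol by (simp add: overall_solution_def hybrid_arc_def)
  next
    case (real r)
    have r: "0 \<le> r"
      using hybrid_norm_nonneg[of E u] sol real by (simp add: overall_solution_def hybrid_arc_def)
    \<comment> \<open>Boundedness is assumed for maximal pairs; completeness makes it available
      here.\<close>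
    have "maximal_pair (overall_solution H) E x u"
      by (rule complete_imp_maximal_pair[where sol = "overall_solution H", OF _ sol complete])
        (auto simp: overall_solution_def hybrid_arc_def)
    with assms(6) have bdd: "bounded (x ` E)"
      by blast
    then obtain M where M: "\<And>p. p \<in> E \<Longrightarrow> norm (x p) \<le> M"
      by (auto simp: bounded_iff)
    have neq: "hybrid_at_top E \<noteq> bot"
      by (rule hybrid_at_top_neq_bot[OF complete])
    define L where "L i = Limsup (hybrid_at_top E) (\<lambda>p. ereal (norm (x p $ i)))" for i
    have L0: "0 \<le> L i" for i
      unfolding L_def by (intro le_Limsup neq always_eventually allI) simp
    have "norm (x p $ i) \<le> M" if "p \<in> E" for p i
      using order_trans[OF Finite_Cartesian_Product.norm_nth_le M[OF that]] .
    \<comment> \<open>Boundedness makes the limits superior finite, so the small-gain argument can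
      run over the reals.\<close>
    then have "L i \<le> ereal M" for i
      unfolding L_def by (intro Limsup_bounded) (auto simp: eventually_hybrid_at_top)
    then have "\<exists>s. L i = ereal s \<and> 0 \<le> s" for i
      using L0[of i] by (cases rule: ereal2_cases[of "L i" "ereal M"]) (auto dest: meta_spec[of _ i])
    then obtain s where s: "\<And>i. L i = ereal (s i)" "\<And>i. 0 \<le> s i"
      by metis
    have dom: "s i \<le> \<gamma>u i r \<or> (\<exists>j. j \<noteq> i \<and> s i \<le> \<gamma>t i j (s j))" for i
      by (rule overall_solution_asymptotic_gain[OF assms(1) assms(4)[rule_format] assms(3) sol
            complete bdd real s(1)[unfolded L_def]])
    have "s i \<le> B i r" for i
      unfolding B_def
      by (rule small_gain_bound[where g = \<gamma>t and v = \<gamma>u and s = s,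
            OF assms(1) \<gamma>t \<gamma>u assms(8)[rule_format, OF conjI] r s(2) dom])
    then have "(\<Sum>i\<in>UNIV. s i) \<le> \<gamma> r"
      using r by (simp add: \<gamma>_def sum_mono add_increasing)
    moreover have "Limsup (hybrid_at_top E) (\<lambda>p. ereal (norm (x p))) \<le> ereal (\<Sum>i\<in>UNIV. s i)"
      unfolding Limsup_le_iff
    proof (intro allI impI)
      fix y assume y: "y > ereal (\<Sum>i\<in>UNIV. s i)"
      then obtain z where z: "(\<Sum>i\<in>UNIV. s i) < z" "ereal z < y"
        using ereal_dense2 by (metis less_ereal.simps(1))
      \<comment> \<open>The gap between the sum and \<open>z\<close> is split evenly, so that the
        enlarged component bounds add up to exactly \<open>z\<close>.\<close>
      define e where "e = (z - (\<Sum>i\<in>UNIV. s i)) / CARD('n)"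
      have "e > 0" using z by (simp add: e_def)
      then have "eventually (\<lambda>p. norm (x p $ i) < s i + e) (hybrid_at_top E)" for i
        using Limsup_lessD[of "hybrid_at_top E" "\<lambda>p. ereal (norm (x p $ i))" "ereal (s i + e)"]
        by (simp add: s(1)[unfolded L_def])
      then have "eventually (\<lambda>p. \<forall>i. norm (x p $ i) < s i + e) (hybrid_at_top E)"
        by (rule eventually_all_finite)
      then show "eventually (\<lambda>p. ereal (norm (x p)) < y) (hybrid_at_top E)"
      proof (rule eventually_mono)
        fix p assume p: "\<forall>i. norm (x p $ i) < s i + e"
        have "norm (x p) \<le> (\<Sum>i\<in>UNIV. norm (x p $ i))"
          unfolding norm_vec_def by (rule L2_set_le_sum) simp
        also have "\<dots> \<le> (\<Sum>i\<in>UNIV. s i + e)"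
          using p by (intro sum_mono) (simp add: less_imp_le)
        also have "\<dots> = z"
          by (simp add: sum.distrib e_def)
        finally show "ereal (norm (x p)) < y"
          using z(2) by (metis ereal_less_eq(3) order_le_less_trans)
      qed
    qed
    ultimately show ?thesis
      by (simp add: real gain_ext_def) (meson ereal_less_eq(3) order_trans)
  qed
  have \<gamma>: "gain \<gamma>"
    using Kinf by (simp add: gain_def)
  have "overall_AG H"
    unfolding overall_AG_def
  proof (intro exI[of _ \<gamma>] conjI allI impI \<gamma>)
    fix E x u assume max: "maximal_pair (overall_solution H) E x u"
    then show "bounded (x ` E)"
      by (rule assms(6)[rule_format])
    assume "complete_domain E"
    moreover have "overall_solution H E x u"
      using max by (simp add: maximal_pair_def)
    ultimately show "Limsup (hybrid_at_top E) (\<lambda>p. ereal (norm (x p))) \<le> gain_ext \<gamma> (hybrid_norm E u)"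
      by (intro bound)
  qed
  then show ?thesis
    by (intro conjI exI[of _ \<gamma>] \<gamma> allI impI) (auto intro: bound)
qed

end
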